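(* Let $0<a_0\le a(x)\le a_1$ on $(0,1)$ and $\frac12<\theta\le1$. Then there is $\tau_0>0$, depending only on $a_0$, $a_1$ and $\theta$, such that the following holds for all $0<\tau\le\tau_0$. Let $V_h\subset H^1(0,1)$ and $Q_h\subset L^2(0,1)$ be finite-dimensional subspaces with $Q_h=\partial_xV_h$ and $1\in V_h$, let $u_0,p_0\in L^2(0,1)$, and let $\{(u_h^n,p_h^n)\}_{n\ge0}\subset V_h\times Q_h$ be the solution of the $\theta$-scheme: $u_h^0=\pi_hu_0$, $p_h^0=\rho_hp_0$ and, for $n\ge1$, $$(\bar\partial_\tau u_h^n,\bar v_h)-(p_h^{n,\theta},\partial_x\bar v_h)+(a u_h^{n,\theta},\bar v_h)=0\quad\text{for all }\bar v_h\in V_h,$$ $$(\bar\partial_\tau p_h^n,\bar q_h)+(\partial_xu_h^{n,\theta},\bar q_h)=0\quad\text{for all }\bar q_h\in Q_h.$$ Then for every integer $k\ge0$, $$E_h^{k,n}\le 3\,e^{-\alpha(n-m)\tau}E_h^{k,m}\qquad\text{for all }k\le m\le n,$$ with $\alpha=\frac23\,\dfrac{a_0^3}{8a_0^2+4a_0^2a_1+3a_0a_1+4a_1^4}$, where $E_h^{k,n}=\frac12\big(\|\bar\partial_\tau^ku_h^n\|^2+\|\bar\partial_\tau^kp_h^n\|^2\big)$.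
   Context: $(\cdot,\cdot)$ and $\|\cdot\|$ are the scalar product and norm of $L^2(0,1)$; $\partial_xV_h=\{\partial_xv:v\in V_h\}$. $\pi_h:L^2(0,1)\to V_h$ and $\rho_h:L^2(0,1)\to Q_h$ are the $L^2$-orthogonal projections. For a sequence $\{w^n\}_{n\ge0}$: $w^{n,\theta}=\theta w^n+(1-\theta)w^{n-1}$, and the backward difference quotients are $\bar\partial_\tau^0w^n=w^n$, $\bar\partial_\tau^{k+1}w^n=\frac1\tau(\bar\partial_\tau^kw^n-\bar\partial_\tau^kw^{n-1})$, $\bar\partial_\tau=\bar\partial_\tau^1$; thus $\bar\partial_\tau^kw^n$ is defined for $n\ge k$. *)

theory Defs
  imports "HOL-Analysis.Analysis"
begin

abbreviation M01 :: "real measure" where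
  "M01 \<equiv> lebesgue_on {0<..<1}"

definition square_integrable :: "(real \<Rightarrow> real) \<Rightarrow> bool" where
  "square_integrable f \<longleftrightarrow> f \<in> borel_measurable M01 \<and> integrable M01 (\<lambda>x. (f x)\<^sup>2)"

definition L2_eq :: "(real \<Rightarrow> real) \<Rightarrow> (real \<Rightarrow> real) \<Rightarrow> bool" where
  "L2_eq f g \<longleftrightarrow> square_integrable f \<and> square_integrable g \<and> (AE x in M01. f x = g x)"

lemma square_integrable_mult:
  assumes "square_integrable f" "square_integrable g"
  shows "integrable M01 (\<lambda>x. f x * g x)"
proof (rule Bochner_Integration.integrable_bound)
  show "integrable M01 (\<lambda>x. (f x)\<^sup>2 + (g x)\<^sup>2)"
    using assms by (simp add: square_integrable_def)
  show "(\<lambda>x. f x * g x) \<in> borel_measurable M01"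
    using assms by (auto simp: square_integrable_def)
  have "\<bar>a * b\<bar> \<le> a\<^sup>2 + b\<^sup>2" for a b :: real
  proof -
    have "0 \<le> (\<bar>a\<bar> - \<bar>b\<bar>)\<^sup>2" by simp
    moreover have "(\<bar>a\<bar> - \<bar>b\<bar>)\<^sup>2 = a\<^sup>2 + b\<^sup>2 - 2 * \<bar>a * b\<bar>"
      by (simp add: power2_diff abs_mult)
    ultimately show ?thesis by linarith
  qed
  then show "AE x in M01. norm (f x * g x) \<le> norm ((f x)\<^sup>2 + (g x)\<^sup>2)"
    by auto
qed

lemma square_integrable_add:
  assumes "square_integrable f" "square_integrable g"
  shows "square_integrable (\<lambda>x. f x + g x)"
proof -
  have "integrable M01 (\<lambda>x. (f x)\<^sup>2 + (g x)\<^sup>2 + 2 * (f x * g x))"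
    using assms square_integrable_mult[OF assms] by (simp add: square_integrable_def)
  moreover have "(\<lambda>x. (f x + g x)\<^sup>2) = (\<lambda>x. (f x)\<^sup>2 + (g x)\<^sup>2 + 2 * (f x * g x))"
    by (simp add: power2_sum algebra_simps fun_eq_iff)
  ultimately show ?thesis
    using assms by (auto simp: square_integrable_def)
qed

lemma square_integrable_scale:
  assumes "square_integrable f"
  shows "square_integrable (\<lambda>x. c * f x)"
  using assms by (auto simp: square_integrable_def power_mult_distrib)

lemma square_integrable_uminus:
  assumes "square_integrable f"
  shows "square_integrable (\<lambda>x. - f x)"
  using assms by (auto simp: square_integrable_def)

lemma square_integrable_diff:
  assumes "square_integrable f" "square_integrable g"
  shows "square_integrable (\<lambda>x. f x - g x)"
  using square_integrable_add[OF assms(1) square_integrable_uminus[OF assms(2)]] by simp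

lemma square_integrable_const: "square_integrable (\<lambda>x. c)"
proof -
  have "emeasure M01 (space M01) \<noteq> \<infinity>"
    by (simp add: emeasure_restrict_space)
  then have "finite_measure M01" by (rule finite_measureI)
  then show ?thesis
    by (simp add: square_integrable_def finite_measure.integrable_const)
qed

lemma square_integrable_bounded_mult:
  assumes "a \<in> borel_measurable M01" "\<forall>x\<in>{0<..<1}. \<bar>a x\<bar> \<le> C" "square_integrable f"
  shows "square_integrable (\<lambda>x. a x * f x)"
  unfolding square_integrable_def
proof
  show m: "(\<lambda>x. a x * f x) \<in> borel_measurable M01"
    using assms by (auto simp: square_integrable_def)
  show "integrable M01 (\<lambda>x. (a x * f x)\<^sup>2)"
  proof (rule Bochner_Integration.integrable_bound)
    show "integrable M01 (\<lambda>x. C\<^sup>2 * (f x)\<^sup>2)"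
      using assms by (simp add: square_integrable_def)
    show "(\<lambda>x. (a x * f x)\<^sup>2) \<in> borel_measurable M01"
      using m by (rule borel_measurable_power)
    have "norm ((a x * f x)\<^sup>2) \<le> norm (C\<^sup>2 * (f x)\<^sup>2)" if "x \<in> space M01" for x
    proof -
      have "\<bar>a x\<bar> \<le> C" using that assms(2) by (auto simp: space_restrict_space)
      then have "(a x)\<^sup>2 \<le> C\<^sup>2" by (metis abs_ge_zero power2_abs power_mono)
      then show ?thesis by (simp add: power_mult_distrib mult_right_mono)
    qed
    then show "AE x in M01. norm ((a x * f x)\<^sup>2) \<le> norm (C\<^sup>2 * (f x)\<^sup>2)"
      by (rule AE_I2)
  qed
qed

quotient_type L2 = "real \<Rightarrow> real" / partial: L2_eq
proof (rule part_equivpI)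
  show "\<exists>f. L2_eq f f"
    using square_integrable_const[of 0] by (auto simp: L2_eq_def)
  show "symp L2_eq"
    by (auto simp: symp_def L2_eq_def)
  show "transp L2_eq"
    by (auto simp: transp_def L2_eq_def elim: AE_mp)
qed

instantiation L2 :: real_inner
begin

lift_definition zero_L2 :: L2 is "\<lambda>x. 0"
  by (simp add: L2_eq_def square_integrable_const)

lift_definition plus_L2 :: "L2 \<Rightarrow> L2 \<Rightarrow> L2" is "\<lambda>f g x. f x + g x"
  by (auto simp: L2_eq_def square_integrable_add)

lift_definition minus_L2 :: "L2 \<Rightarrow> L2 \<Rightarrow> L2" is "\<lambda>f g x. f x - g x"
  by (auto simp: L2_eq_def square_integrable_diff)

lift_definition uminus_L2 :: "L2 \<Rightarrow> L2" is "\<lambda>f x. - f x"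
  by (auto simp: L2_eq_def square_integrable_uminus)

lift_definition scaleR_L2 :: "real \<Rightarrow> L2 \<Rightarrow> L2" is "\<lambda>c f x. c * f x"
  by (auto simp: L2_eq_def square_integrable_scale)

lift_definition inner_L2 :: "L2 \<Rightarrow> L2 \<Rightarrow> real" is "\<lambda>f g. LINT x|M01. f x * g x"
  by (intro integral_cong_AE) (auto simp: L2_eq_def square_integrable_def)

definition norm_L2 :: "L2 \<Rightarrow> real" where
  "norm_L2 f = sqrt (inner f f)"

definition dist_L2 :: "L2 \<Rightarrow> L2 \<Rightarrow> real" where
  "dist_L2 f g = norm (f - g)"

definition sgn_L2 :: "L2 \<Rightarrow> L2" where
  "sgn_L2 f = scaleR (inverse (norm f)) f"

definition uniformity_L2 :: "(L2 \<times> L2) filter" where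
  "uniformity_L2 = (INF e\<in>{0<..}. principal {(x, y). dist x y < e})"

definition open_L2 :: "L2 set \<Rightarrow> bool" where
  "open_L2 U \<longleftrightarrow> (\<forall>x\<in>U. eventually (\<lambda>(x', y). x' = x \<longrightarrow> y \<in> U) uniformity)"

instance
proof
  fix f g h :: L2 and r s :: real
  show "f + g + h = f + (g + h)"
    by transfer (auto simp: L2_eq_def square_integrable_add add.assoc)
  show "f + g = g + f"
    by transfer (auto simp: L2_eq_def square_integrable_add add.commute)
  show "0 + f = f"
    by transfer (auto simp: L2_eq_def)
  show "- f + f = 0"
    by transfer (auto simp: L2_eq_def square_integrable_const)
  show "f - g = f + - g"
    by transfer (auto simp: L2_eq_def square_integrable_diff)
  show "r *\<^sub>R (f + g) = r *\<^sub>R f + r *\<^sub>R g"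
    by transfer (auto simp: L2_eq_def distrib_left
        intro!: square_integrable_add square_integrable_scale)
  show "(r + s) *\<^sub>R f = r *\<^sub>R f + s *\<^sub>R f"
    by transfer (auto simp: L2_eq_def distrib_right
        intro!: square_integrable_add square_integrable_scale)
  show "r *\<^sub>R s *\<^sub>R f = (r * s) *\<^sub>R f"
    by transfer (auto simp: L2_eq_def mult.assoc intro!: square_integrable_scale)
  show "1 *\<^sub>R f = f"
    by transfer (auto simp: L2_eq_def)
  show "dist f g = norm (f - g)" by (rule dist_L2_def)
  show "sgn f = inverse (norm f) *\<^sub>R f" by (rule sgn_L2_def)
  show "(uniformity :: (L2 \<times> L2) filter) = (INF e\<in>{0<..}. principal {(x, y). dist x y < e})"
    by (rule uniformity_L2_def)
  show "open U \<longleftrightarrow> (\<forall>x\<in>U. eventually (\<lambda>(x', y). x' = x \<longrightarrow> y \<in> U) uniformity)" for U :: "L2 set"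
    by (rule open_L2_def)
  show "norm f = sqrt (inner f f)" by (rule norm_L2_def)
  show "inner f g = inner g f"
    by transfer (simp add: mult.commute)
  show "inner (f + g) h = inner f h + inner g h"
    by transfer (simp add: L2_eq_def distrib_right square_integrable_mult)
  show "inner (r *\<^sub>R f) g = r * inner f g"
    by transfer (simp add: mult.assoc)
  show "0 \<le> inner f f"
    by transfer simp
  show "inner f f = 0 \<longleftrightarrow> f = 0"
  proof (transfer, goal_cases)
    case (1 f)
    then have "integrable M01 (\<lambda>x. f x * f x)"
      by (simp add: L2_eq_def square_integrable_mult)
    then have "(LINT x|M01. f x * f x) = 0 \<longleftrightarrow> (AE x in M01. f x * f x = 0)"
      by (intro integral_nonneg_eq_0_iff_AE) auto
    with 1 show ?case
      by (simp add: L2_eq_def square_integrable_const)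
  qed
qed

end

lift_definition const_L2 :: "real \<Rightarrow> L2" is "\<lambda>c x. c"
  by (simp add: L2_eq_def square_integrable_const)

text \<open>Multiplication by a bounded measurable coefficient; the value for other
  coefficients is a dummy.\<close>

lift_definition coeff_mult :: "(real \<Rightarrow> real) \<Rightarrow> L2 \<Rightarrow> L2" is
  "\<lambda>a f. if a \<in> borel_measurable M01 \<and> (\<exists>C. \<forall>x\<in>{0<..<1}. \<bar>a x\<bar> \<le> C)
         then (\<lambda>x. a x * f x) else (\<lambda>x. 0)"
  subgoal premises prems for a f g
  proof (cases "a \<in> borel_measurable M01 \<and> (\<exists>C. \<forall>x\<in>{0<..<1}. \<bar>a x\<bar> \<le> C)")
    case True
    then obtain C where "a \<in> borel_measurable M01" "\<forall>x\<in>{0<..<1}. \<bar>a x\<bar> \<le> C"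
      by blast
    then have "L2_eq (\<lambda>x. a x * f x) (\<lambda>x. a x * g x)"
      using prems by (auto simp: L2_eq_def intro: square_integrable_bounded_mult)
    then show ?thesis by (simp only: True if_True simp_thms)
  next
    case False
    have "L2_eq (\<lambda>x. 0) (\<lambda>x. 0)"
      by (simp add: L2_eq_def square_integrable_const)
    then show ?thesis by (simp only: False if_False)
  qed
  done

text \<open>The test functions \<open>C\<^sub>c\<^sup>\<infinity>(0,1)\<close>, extended by zero to the real line.\<close>

definition test_function :: "(real \<Rightarrow> real) \<Rightarrow> bool" where
  "test_function \<phi> \<longleftrightarrow>
     (\<forall>k x. (deriv ^^ k) \<phi> field_differentiable at x) \<and>
     (\<exists>K. compact K \<and> K \<subseteq> {0<..<1} \<and> (\<forall>x. x \<notin> K \<longrightarrow> \<phi> x = 0))"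

lemma test_function_measurable:
  assumes "test_function \<phi>"
  shows "(deriv ^^ k) \<phi> \<in> borel_measurable M01"
proof -
  have "continuous_on UNIV ((deriv ^^ k) \<phi>)"
    using assms by (auto simp: test_function_def continuous_on_eq_continuous_within
        intro: field_differentiable_imp_continuous_at)
  then have "(deriv ^^ k) \<phi> \<in> borel_measurable lebesgue"
    by (intro measurable_completion) (simp add: borel_measurable_continuous_onI)
  then show ?thesis
    by (rule measurable_restrict_space1)
qed

lift_definition has_weak_deriv :: "L2 \<Rightarrow> L2 \<Rightarrow> bool" is
  "\<lambda>u g. \<forall>\<phi>. test_function \<phi> \<longrightarrow>
     (LINT x|M01. u x * deriv \<phi> x) = - (LINT x|M01. g x * \<phi> x)"
proof -
  fix u u' g g' :: "real \<Rightarrow> real"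
  assume *: "L2_eq u u'" "L2_eq g g'"
  have "(LINT x|M01. u x * deriv \<phi> x) = (LINT x|M01. u' x * deriv \<phi> x)"
       "(LINT x|M01. g x * \<phi> x) = (LINT x|M01. g' x * \<phi> x)"
    if "test_function \<phi>" for \<phi>
    using * test_function_measurable[OF that, of 0] test_function_measurable[OF that, of 1]
    by (auto simp: L2_eq_def square_integrable_def intro!: integral_cong_AE)
  then show "(\<forall>\<phi>. test_function \<phi> \<longrightarrow>
       (LINT x|M01. u x * deriv \<phi> x) = - (LINT x|M01. g x * \<phi> x)) \<longleftrightarrow>
     (\<forall>\<phi>. test_function \<phi> \<longrightarrow>
       (LINT x|M01. u' x * deriv \<phi> x) = - (LINT x|M01. g' x * \<phi> x))"
    by auto
qed

definition H1 :: "L2 set" where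
  "H1 = {u. \<exists>g. has_weak_deriv u g}"

definition weak_deriv :: "L2 \<Rightarrow> L2" where
  "weak_deriv u = (THE g. has_weak_deriv u g)"

definition fin_dim_subspace :: "L2 set \<Rightarrow> bool" where
  "fin_dim_subspace V \<longleftrightarrow> subspace V \<and> (\<exists>B. finite B \<and> span B = V)"

definition L2_proj :: "L2 set \<Rightarrow> L2 \<Rightarrow> L2" where
  "L2_proj V f = (THE g. g \<in> V \<and> (\<forall>v\<in>V. inner (f - g) v = 0))"

definition theta_avg :: "real \<Rightarrow> (nat \<Rightarrow> L2) \<Rightarrow> nat \<Rightarrow> L2" where
  "theta_avg \<theta> w n = \<theta> *\<^sub>R w n + (1 - \<theta>) *\<^sub>R w (n - 1)"

text \<open>Meaningful for \<open>n \<ge> k\<close> only; below that the truncated \<open>n - 1\<close> yields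
  dummy values.\<close>

primrec bdq :: "real \<Rightarrow> nat \<Rightarrow> (nat \<Rightarrow> L2) \<Rightarrow> nat \<Rightarrow> L2" where
  "bdq \<tau> 0 w n = w n"
| "bdq \<tau> (Suc k) w n = (1 / \<tau>) *\<^sub>R (bdq \<tau> k w n - bdq \<tau> k w (n - 1))"

definition theta_scheme ::
  "real \<Rightarrow> real \<Rightarrow> (real \<Rightarrow> real) \<Rightarrow> L2 set \<Rightarrow> L2 set \<Rightarrow> L2 \<Rightarrow> L2 \<Rightarrow>
   (nat \<Rightarrow> L2) \<Rightarrow> (nat \<Rightarrow> L2) \<Rightarrow> bool" where
  "theta_scheme \<theta> \<tau> a V Q u0 p0 u p \<longleftrightarrow>
     (\<forall>n. u n \<in> V \<and> p n \<in> Q) \<and>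
     u 0 = L2_proj V u0 \<and> p 0 = L2_proj Q p0 \<and>
     (\<forall>n\<ge>1.
        (\<forall>v\<in>V. inner (bdq \<tau> 1 u n) v - inner (theta_avg \<theta> p n) (weak_deriv v)
                 + inner (coeff_mult a (theta_avg \<theta> u n)) v = 0) \<and>
        (\<forall>q\<in>Q. inner (bdq \<tau> 1 p n) q + inner (weak_deriv (theta_avg \<theta> u n)) q = 0))"

definition energy :: "real \<Rightarrow> (nat \<Rightarrow> L2) \<Rightarrow> (nat \<Rightarrow> L2) \<Rightarrow> nat \<Rightarrow> nat \<Rightarrow> real" where
  "energy \<tau> u p k n = 1 / 2 * ((norm (bdq \<tau> k u n))\<^sup>2 + (norm (bdq \<tau> k p n))\<^sup>2)"

definition decay_rate :: "real \<Rightarrow> real \<Rightarrow> real" where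
  "decay_rate a0 a1 =
     2 / 3 * (a0 ^ 3 / (8 * a0\<^sup>2 + 4 * a0\<^sup>2 * a1 + 3 * a0 * a1 + 4 * a1 ^ 4))"

end

theory Submission
  imports Defs
begin

text \<open>For \<open>p \<in> Q\<close> let \<open>r \<in> V\<close> be the mean-zero function with \<open>\<partial>\<^sub>xr = p\<close>; it exists because
  \<open>Q = \<partial>\<^sub>xV\<close> and \<open>1 \<in> V\<close>, and the Poincare inequality gives \<open>\<parallel>r\<parallel> \<le> \<parallel>p\<parallel>\<close>. The damping controls only
  \<open>u\<close>, so the energy \<open>E\<close> is replaced by the equivalent functional \<open>L = E - \<epsilon> (u, r)\<close> with
  \<open>\<epsilon> = 3/2 \<alpha>\<close>: testing the first equation with \<open>r\<close> produces the missing term \<open>- \<epsilon> \<parallel>p\<parallel>\<^sup>2\<close>. For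
  \<open>\<theta> > 1/2\<close> the numerical dissipation \<open>(\<theta> - 1/2) (\<parallel>u\<^sup>n - u\<^sup>n\<^sup>-\<^sup>1\<parallel>\<^sup>2 + \<parallel>p\<^sup>n - p\<^sup>n\<^sup>-\<^sup>1\<parallel>\<^sup>2)\<close> absorbs all
  discretisation errors once \<open>\<tau> \<le> (\<theta> - 1/2) / 2\<close>, so that \<open>L\<^sup>n \<le> (1 - 8/11 \<epsilon>\<tau>) L\<^sup>n\<^sup>-\<^sup>1\<close>. The difference
  quotients solve the same scheme, hence decay in the same way.\<close>

section \<open>Test functions\<close>

text \<open>The functions \<open>q(1/x) exp(-1/x)\<close>, extended by zero to \<open>x \<le> 0\<close>, are closed under
  differentiation, which yields smoothness.\<close>

definition flat_exp :: "real poly \<Rightarrow> real \<Rightarrow> real" where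
  "flat_exp p x = (if x > 0 then poly p (1 / x) * exp (- 1 / x) else 0)"

lemma poly_times_exp_minus_tendsto_0:
  fixes p :: "real poly"
  shows "((\<lambda>x. poly p x * exp (- x)) \<longlongrightarrow> 0) at_top"
proof -
  have "((\<lambda>x. \<Sum>i\<le>degree p. coeff p i * (x ^ i / exp x)) \<longlongrightarrow> (\<Sum>i\<le>degree p. coeff p i * 0)) at_top"
    by (intro tendsto_sum tendsto_mult tendsto_const tendsto_power_div_exp_0)
  then show ?thesis
    by (simp add: poly_altdef sum_distrib_right exp_minus field_simps sum_divide_distrib)
qed

text \<open>With \<open>y = 1/x\<close> and \<open>dy/dx = -y^2\<close>, differentiating
  \<open>p(y) exp(-y)\<close> in \<open>x\<close> gives \<open>y^2 (p(y) - p'(y)) exp(-y)\<close>;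
  the factor \<open>y^2\<close> is the polynomial \<open>[:0, 0, 1:]\<close>. At 0 the two one-sided
  limits of the difference quotient are computed separately.\<close>

lemma has_derivative_flat_exp:
  "(flat_exp p has_real_derivative flat_exp ([:0, 0, 1:] * (p - pderiv p)) x) (at x)"
proof -
  consider "x > 0" | "x < 0" | "x = 0" by linarith
  then show ?thesis
  proof cases
    case 1
    have "((\<lambda>x. poly p (1 / x) * exp (- 1 / x)) has_real_derivative
        flat_exp ([:0, 0, 1:] * (p - pderiv p)) x) (at x)"
      using 1 by (auto simp: flat_exp_def field_simps power2_eq_square intro!: derivative_eq_intros)
    then show ?thesis
      by (rule has_field_derivative_transform_within_open[where S = "{0<..}"])
        (use 1 in \<open>auto simp: flat_exp_def\<close>)
  next
    case 2
    have "((\<lambda>x. 0) has_real_derivative 0) (at x)" by simp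
    then have "(flat_exp p has_real_derivative 0) (at x)"
      by (rule has_field_derivative_transform_within_open[where S = "{..<0}"])
        (use 2 in \<open>auto simp: flat_exp_def\<close>)
    then show ?thesis using 2 by (simp add: flat_exp_def)
  next
    case 3
    \<comment> \<open>For \<open>h > 0\<close> and \<open>y = 1/h\<close> the quotient
      \<open>flat_exp p h / h\<close> is \<open>y p(y) exp(-y)\<close>, and \<open>pCons 0 p\<close>
      is the polynomial \<open>y p(y)\<close>.\<close>
    have "((\<lambda>h. poly (pCons 0 p) (inverse h) * exp (- inverse h)) \<longlongrightarrow> 0) (at_right 0)"
      using poly_times_exp_minus_tendsto_0[of "pCons 0 p"]
      by (rule filterlim_compose) (rule filterlim_inverse_at_top_right)
    then have "((\<lambda>h. flat_exp p h / h) \<longlongrightarrow> 0) (at_right 0)"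
      by (rule Lim_transform_eventually)
        (auto simp: flat_exp_def eventually_at_filter divide_simps)
    moreover have "((\<lambda>h. flat_exp p h / h) \<longlongrightarrow> 0) (at_left 0)"
      by (rule Lim_transform_eventually[OF tendsto_const])
        (auto simp: flat_exp_def eventually_at_filter)
    ultimately have "((\<lambda>h. flat_exp p h / h) \<longlongrightarrow> 0) (at 0)"
      by (simp add: filterlim_split_at)
    then show ?thesis using 3 by (simp add: DERIV_def flat_exp_def)
  qed
qed

text \<open>Differentiating a product of two flat functions of affine arguments gives sums of such
  products with constant factors from the chain rule. Closing under all these operations makes one
  derivative stay in the class, so smoothness follows by induction.\<close>

inductive_set flat_alg :: "(real \<Rightarrow> real) set" where
  flat: "(\<lambda>x. flat_exp p (s * x + t)) \<in> flat_alg"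
| const: "(\<lambda>x. c) \<in> flat_alg"
| add: "f \<in> flat_alg \<Longrightarrow> g \<in> flat_alg \<Longrightarrow> (\<lambda>x. f x + g x) \<in> flat_alg"
| mult: "f \<in> flat_alg \<Longrightarrow> g \<in> flat_alg \<Longrightarrow> (\<lambda>x. f x * g x) \<in> flat_alg"

lemma flat_alg_derivative:
  "f \<in> flat_alg \<Longrightarrow> \<exists>f'\<in>flat_alg. \<forall>x. (f has_real_derivative f' x) (at x)"
proof (induction rule: flat_alg.induct)
  case (flat p s t)
  let ?q = "[:0, 0, 1:] * (p - pderiv p)"
  have "((\<lambda>x. flat_exp p (s * x + t)) has_real_derivative flat_exp ?q (s * x + t) * s) (at x)" for x
    by (rule DERIV_chain2[OF has_derivative_flat_exp]) (auto intro!: derivative_eq_intros)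
  moreover have "(\<lambda>x. flat_exp ?q (s * x + t) * s) \<in> flat_alg"
    by (intro flat_alg.intros)
  ultimately show ?case by (rule_tac bexI) auto
next
  case (const c)
  then show ?case using flat_alg.const[of 0] by (rule_tac bexI) auto
next
  case (add f g)
  then obtain f' g' where "f' \<in> flat_alg" "g' \<in> flat_alg"
    "\<And>x. (f has_real_derivative f' x) (at x)" "\<And>x. (g has_real_derivative g' x) (at x)"
    by blast
  then show ?case
    by (intro bexI[of _ "\<lambda>x. f' x + g' x"]) (auto intro: flat_alg.intros DERIV_add)
next
  case (mult f g)
  then obtain f' g' where "f' \<in> flat_alg" "g' \<in> flat_alg"
    "\<And>x. (f has_real_derivative f' x) (at x)" "\<And>x. (g has_real_derivative g' x) (at x)"
    by blast
  then show ?case using mult.hyps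
    by (intro bexI[of _ "\<lambda>x. f' x * g x + g' x * f x"]) (auto intro: flat_alg.intros DERIV_mult)
qed

lemma deriv_funpow_flat_alg: "f \<in> flat_alg \<Longrightarrow> (deriv ^^ k) f \<in> flat_alg"
proof (induction k)
  case (Suc k)
  then obtain f' where "f' \<in> flat_alg" "\<forall>x. ((deriv ^^ k) f has_real_derivative f' x) (at x)"
    using flat_alg_derivative by blast
  moreover from this have "deriv ((deriv ^^ k) f) = f'"
    by (auto intro: DERIV_imp_deriv)
  ultimately show ?case by simp
qed simp

section \<open>Bump functions approximating indicators of intervals\<close>

definition bump :: "real \<Rightarrow> real \<Rightarrow> nat \<Rightarrow> real \<Rightarrow> real" where
  "bump c d n x = flat_exp 1 (real (Suc n) * (x - c)) * flat_exp 1 (real (Suc n) * (d - x))"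

lemma bump_outside: "x \<notin> {c<..<d} \<Longrightarrow> bump c d n x = 0"
  by (auto simp: bump_def flat_exp_def zero_less_mult_iff)

lemma test_function_bump:
  assumes "0 < c" "d < 1"
  shows "test_function (bump c d n)"
proof -
  have *: "bump c d n = (\<lambda>x. flat_exp 1 (real (Suc n) * x + (- real (Suc n) * c)) *
     flat_exp 1 ((- real (Suc n)) * x + real (Suc n) * d))"
    by (auto simp: bump_def fun_eq_iff algebra_simps)
  have "bump c d n \<in> flat_alg"
    unfolding * by (intro flat_alg.intros)
  then have "(deriv ^^ k) (bump c d n) field_differentiable at x" for k x
    using deriv_funpow_flat_alg flat_alg_derivative unfolding field_differentiable_def by meson
  moreover have "compact {c..d}" "{c..d} \<subseteq> {0<..<1}" "\<forall>x. x \<notin> {c..d} \<longrightarrow> bump c d n x = 0"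
    using assms by (auto intro!: bump_outside)
  ultimately show ?thesis unfolding test_function_def by blast
qed

lemma flat_exp_1_bounds: "0 \<le> flat_exp 1 x" "flat_exp 1 x \<le> 1"
  by (auto simp: flat_exp_def)

lemma bump_bounds: "0 \<le> bump c d n x" "bump c d n x \<le> 1"
  unfolding bump_def
  using flat_exp_1_bounds by (auto intro!: mult_nonneg_nonneg mult_le_one)

text \<open>The endpoints move inside (0,1), so that for arbitrary \<open>c\<close> and
  \<open>d\<close> every member of the sequence is a test function, while the slope
  \<open>Suc n\<close> drives both factors to 1 at each interior point.\<close>

lemma bump_tendsto_indicator:
  "(\<lambda>n. bump (max c (1 / real (n + 2))) (min d (1 - 1 / real (n + 2))) n x)
     \<longlonglongrightarrow> indicator ({0<..<1} \<inter> {c<..<d}) x"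
proof (cases "x \<in> {0<..<1} \<inter> {c<..<d}")
  case True
  have lim1: "(flat_exp 1 \<longlongrightarrow> 1) at_top"
  proof -
    have "((\<lambda>y::real. exp (- inverse y)) \<longlongrightarrow> exp (- 0)) at_top"
      by (intro tendsto_intros tendsto_inverse_0_at_top filterlim_ident)
    then have "((\<lambda>y::real. exp (- inverse y)) \<longlongrightarrow> 1) at_top" by simp
    then show ?thesis
      by (rule Lim_transform_eventually)
        (use eventually_gt_at_top[of 0] in \<open>auto simp: flat_exp_def divide_inverse elim!: eventually_mono\<close>)
  qed
  have "(\<lambda>n. inverse (real (Suc n))) \<longlonglongrightarrow> 0" by (rule LIMSEQ_inverse_real_of_nat)
  then have 0: "(\<lambda>n. 1 / real (n + 2)) \<longlonglongrightarrow> 0"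
    by (drule_tac LIMSEQ_Suc) (simp add: divide_inverse)
  \<comment> \<open>The distances to the moving endpoints have positive limits, so multiplied by
    \<open>Suc n\<close> they tend to infinity, where \<open>flat_exp 1\<close> tends to 1.\<close>
  have *: "(\<lambda>n. flat_exp 1 (real (Suc n) * y n)) \<longlonglongrightarrow> 1" if "y \<longlonglongrightarrow> l" "l > 0" for y l
    by (rule filterlim_compose[OF lim1])
      (intro filterlim_at_top_mult_tendsto_pos[OF that]
        filterlim_compose[OF filterlim_real_sequentially filterlim_Suc])
  have l: "max c 0 < x" "x < min d (1 - 0)" using True by auto
  have "(\<lambda>n. bump (max c (1 / real (n + 2))) (min d (1 - 1 / real (n + 2))) n x) \<longlonglongrightarrow> 1 * 1"
    unfolding bump_def
    by (rule tendsto_mult;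
        rule *[OF tendsto_diff[OF tendsto_const tendsto_max[OF tendsto_const 0]]]
             *[OF tendsto_diff[OF tendsto_min[OF tendsto_const tendsto_diff[OF tendsto_const 0]] tendsto_const]];
        use l in simp)
  then show ?thesis using True by simp
next
  case False
  have "0 < 1 / real (n + 2)" for n by simp
  then have "x \<notin> {max c (1 / real (n + 2))<..<min d (1 - 1 / real (n + 2))}" for n
    using False by (smt (verit) IntI greaterThanLessThan_iff max_def min_def)
  then show ?thesis using False by (simp add: bump_outside)
qed

section \<open>Calculus of test functions\<close>

lemma test_function_iterated_deriv_continuous:
  "test_function \<phi> \<Longrightarrow> continuous_on S ((deriv ^^ k) \<phi>)"
  by (meson continuous_at_imp_continuous_on field_differentiable_imp_continuous_at
      test_function_def)

lemma test_function_has_deriv: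
  "test_function \<phi> \<Longrightarrow> (\<phi> has_real_derivative deriv \<phi> x) (at x)"
  unfolding test_function_def by (metis DERIV_deriv_iff_field_differentiable funpow_0)

lemma test_function_support:
  assumes "test_function \<phi>"
  obtains c d where "0 < c" "c < d" "d < 1" "\<And>x. x \<notin> {c..d} \<Longrightarrow> \<phi> x = 0"
proof -
  obtain K where K: "compact K" "K \<subseteq> {0<..<1}" "\<And>x. x \<notin> K \<Longrightarrow> \<phi> x = 0"
    using assms unfolding test_function_def by blast
  show thesis
  proof (cases "K = {}")
    case True
    then show thesis using that[of "1/3" "2/3"] K by auto
  next
    case False
    obtain c where c: "c \<in> K" "\<And>x. x \<in> K \<Longrightarrow> c \<le> x"
      using compact_attains_inf[OF K(1) False] by blast
    obtain d where d: "d \<in> K" "\<And>x. x \<in> K \<Longrightarrow> x \<le> d"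
      using compact_attains_sup[OF K(1) False] by blast
    \<comment> \<open>Halving the lower endpoint keeps the interval nondegenerate even if
      \<open>K\<close> is a single point.\<close>
    have "0 < c / 2" "c / 2 < d" "d < 1" using c d K by force+
    moreover have "\<phi> x = 0" if "x \<notin> {c / 2..d}" for x
    proof (rule K(3), rule)
      assume "x \<in> K"
      then show False using that c(2)[of x] d(2)[of x] \<open>0 < c / 2\<close> by auto
    qed
    ultimately show thesis by (rule that)
  qed
qed

lemma test_function_deriv:
  assumes "test_function \<phi>"
  shows "test_function (deriv \<phi>)"
proof -
  obtain K where K: "compact K" "K \<subseteq> {0<..<1}" "\<And>x. x \<notin> K \<Longrightarrow> \<phi> x = 0"
    using assms unfolding test_function_def by blast
  have "deriv \<phi> x = 0" if "x \<notin> K" for x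
  proof (rule DERIV_imp_deriv)
    have "((\<lambda>x. 0) has_real_derivative 0) (at x)" by simp
    then show "(\<phi> has_real_derivative 0) (at x)"
      by (rule has_field_derivative_transform_within_open[where S = "- K"])
        (use that K compact_imp_closed in auto)
  qed
  moreover have "(deriv ^^ k) (deriv \<phi>) field_differentiable at x" for k x
    using assms unfolding test_function_def by (metis comp_apply funpow_Suc_right)
  ultimately show ?thesis
    unfolding test_function_def using K by blast
qed

lemma test_function_diff_scale:
  assumes "test_function \<phi>" "test_function \<psi>"
  shows "test_function (\<lambda>x. \<phi> x - c * \<psi> x)"
proof -
  have d: "((deriv ^^ k) \<phi> has_real_derivative (deriv ^^ Suc k) \<phi> x) (at x)"
    "((deriv ^^ k) \<psi> has_real_derivative (deriv ^^ Suc k) \<psi> x) (at x)" for k x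
    using assms unfolding test_function_def
    by (auto simp: DERIV_deriv_iff_field_differentiable)
  then have dd: "((\<lambda>x. (deriv ^^ k) \<phi> x - c * (deriv ^^ k) \<psi> x) has_real_derivative
      (deriv ^^ Suc k) \<phi> x - c * (deriv ^^ Suc k) \<psi> x) (at x)" for k x
    by (intro DERIV_diff DERIV_cmult)
  have "(deriv ^^ k) (\<lambda>x. \<phi> x - c * \<psi> x) = (\<lambda>x. (deriv ^^ k) \<phi> x - c * (deriv ^^ k) \<psi> x)" for k
  proof (induction k)
    case (Suc k)
    then show ?case using DERIV_imp_deriv[OF dd[of k]] by simp
  qed simp
  then have "(deriv ^^ k) (\<lambda>x. \<phi> x - c * \<psi> x) field_differentiable at x" for k x
    using dd unfolding field_differentiable_def by metis
  moreover obtain K L where "compact K" "K \<subseteq> {0<..<1}" "\<And>x. x \<notin> K \<Longrightarrow> \<phi> x = 0"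
     "compact L" "L \<subseteq> {0<..<1}" "\<And>x. x \<notin> L \<Longrightarrow> \<psi> x = 0"
    using assms unfolding test_function_def by blast
  then have "compact (K \<union> L)" "K \<union> L \<subseteq> {0<..<1}" "\<forall>x. x \<notin> K \<union> L \<longrightarrow> \<phi> x - c * \<psi> x = 0"
    by auto
  ultimately show ?thesis unfolding test_function_def by blast
qed

lemma test_function_bounded:
  assumes "test_function \<phi>"
  obtains B where "0 \<le> B" "\<And>x. \<bar>\<phi> x\<bar> \<le> B"
proof -
  obtain K where K: "compact K" "\<And>x. x \<notin> K \<Longrightarrow> \<phi> x = 0"
    using assms unfolding test_function_def by blast
  have "bounded (\<phi> ` K)"
    using test_function_iterated_deriv_continuous[OF assms, of K 0] K(1)
    by (auto intro: compact_imp_bounded compact_continuous_image)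
  then obtain B where "0 < B" "\<And>x. x \<in> K \<Longrightarrow> \<bar>\<phi> x\<bar> \<le> B"
    by (auto simp: bounded_pos)
  then show thesis using that[of B] K(2) by (metis abs_zero less_imp_le)
qed

lemma test_function_square_integrable:
  assumes "test_function \<phi>"
  shows "square_integrable \<phi>"
proof -
  obtain B where "\<And>x. \<bar>\<phi> x\<bar> \<le> B" using test_function_bounded[OF assms] by blast
  then show ?thesis
    using square_integrable_bounded_mult[of \<phi> B "\<lambda>x. 1"] square_integrable_const[of 1]
      test_function_measurable[OF assms, of 0] by simp
qed

section \<open>The fundamental lemma of the calculus of variations\<close>

lemma integrable_M01_if_square_integrable: "square_integrable f \<Longrightarrow> integrable M01 f"
  using square_integrable_mult[OF _ square_integrable_const[of 1], of f] by simp

lemma emeasure_M01: "emeasure M01 (space M01) = 1" "measure M01 (space M01) = 1"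
  by (simp_all add: emeasure_restrict_space measure_restrict_space)

lemma finite_measure_M01: "finite_measure M01"
  by (rule finite_measureI) (metis emeasure_M01(1) ennreal_one_neq_top infinity_ennreal_def)

text \<open>It suffices that \<open>f\<close> integrates to zero over every measurable set. For open
  intervals this follows by dominated convergence along the bumps, for closed ones because endpoints
  are null, for Borel sets by induction over complements and disjoint unions, and for Lebesgue sets
  because they are Borel up to a null set.\<close>

lemma test_function_orthogonal_imp_AE_0:
  assumes f: "square_integrable f"
    and 0: "\<And>\<phi>. test_function \<phi> \<Longrightarrow> (LINT x|M01. f x * \<phi> x) = 0"
  shows "AE x in M01. f x = 0"
proof -
  interpret finite_measure M01 by (rule finite_measure_M01)
  show ?thesis
  proof (rule density_zero)
    show int: "integrable M01 f"  using f by (rule integrable_M01_if_square_integrable)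
    then have [measurable]: "f \<in> borel_measurable M01" by simp
    have intm: "integrable M01 (\<lambda>x. indicator A x * f x)" if "A \<in> sets borel" for A
    proof (rule Bochner_Integration.integrable_bound[OF int])
      have "A \<in> sets lebesgue" using that by simp
      then have [measurable]: "indicator A \<in> borel_measurable M01"
        by (intro measurable_restrict_space1 borel_measurable_indicator)
      show "(\<lambda>x. indicator A x * f x) \<in> borel_measurable M01" by simp
    qed (auto simp: indicator_def)
    have ioo: "(LINT x|M01. indicator {c<..<d} x * f x) = 0" for c d
    proof -
      let ?\<phi> = "\<lambda>n. bump (max c (1 / real (n + 2))) (min d (1 - 1 / real (n + 2))) n"
      have \<phi>: "test_function (?\<phi> n)" for n by (rule test_function_bump)
        (auto simp: less_max_iff_disj min_less_iff_disj)
      have "(\<lambda>n. LINT x|M01. f x * ?\<phi> n x) \<longlonglongrightarrow> (LINT x|M01. indicator {c<..<d} x * f x)"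
      proof (rule integral_dominated_convergence[where w = "\<lambda>x. \<bar>f x\<bar>"])
        show "(\<lambda>x. indicator {c<..<d} x * f x) \<in> borel_measurable M01"
          using intm[of "{c<..<d}"] by simp
        show "(\<lambda>x. f x * ?\<phi> n x) \<in> borel_measurable M01" for n
          using test_function_measurable[OF \<phi>[of n], of 0] by simp
        show "AE x in M01. (\<lambda>n. f x * ?\<phi> n x) \<longlonglongrightarrow> indicator {c<..<d} x * f x"
        proof (rule AE_I2)
          fix x assume "x \<in> space M01"
          then have "x \<in> {0<..<1}" by (simp add: space_restrict_space)
          then have "indicator ({0<..<1} \<inter> {c<..<d}) x = (indicator {c<..<d} x :: real)"
            by (auto simp: indicator_def)
          then show "(\<lambda>n. f x * ?\<phi> n x) \<longlonglongrightarrow> indicator {c<..<d} x * f x"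
            using tendsto_mult[OF tendsto_const[of "f x"] bump_tendsto_indicator[of c d x]]
            by (simp add: mult.commute)
        qed
        show "AE x in M01. norm (f x * ?\<phi> n x) \<le> \<bar>f x\<bar>" for n
          by (rule AE_I2) (simp add: abs_mult bump_bounds mult_left_le)
      qed (use int in auto)
      then show ?thesis unfolding 0[OF \<phi>] by (simp add: LIMSEQ_const_iff)
    qed
    have null: "AE x in M01. x \<notin> N" if "N \<in> null_sets lebesgue" for N
      using AE_not_in[OF that] by (subst AE_restrict_space_iff) (auto elim!: eventually_mono)
    have borel: "(LINT x|M01. indicator A x * f x) = 0" if "A \<in> sets borel" for A
      using that
    proof (induction rule: borel_set_induct)
      case (interval a b)
      have "{a, b} \<in> null_sets lebesgue" by (simp add: null_sets_completionI)
      then have "AE x in M01. x \<notin> {a, b}" by (rule null)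
      then have "(LINT x|M01. indicator {a..b} x * f x) = (LINT x|M01. indicator {a<..<b} x * f x)"
        using intm[of "{a..b}"] intm[of "{a<..<b}"]
        by (intro integral_cong_AE) (auto simp: indicator_def elim!: AE_mp)
      then show ?case by (simp add: ioo)
    next
      \<comment> \<open>On the space (0,1) the complement amounts to \<open>{0<..<1}\<close> minus
        \<open>A\<close>, and the integral over (0,1) already vanishes.\<close>
      case (compl A)
      have "(LINT x|M01. indicator (- A) x * f x) = (LINT x|M01. indicator {0<..<1} x * f x - indicator A x * f x)"
        by (intro Bochner_Integration.integral_cong) (auto simp: space_restrict_space indicator_def)
      also have "\<dots> = 0"
        using compl intm[of A] intm[of "{0<..<1}"] ioo[of 0 1] by simp
      finally show ?case .
    next
      case (union A)
      have "(\<lambda>n. LINT x|M01. (\<Sum>i<n. indicator (A i) x * f x)) \<longlonglongrightarrow> (LINT x|M01. indicator (\<Union>i. A i) x * f x)"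
      proof (rule integral_dominated_convergence[where w = "\<lambda>x. \<bar>f x\<bar>"])
        show "(\<lambda>x. indicator (\<Union>i. A i) x * f x) \<in> borel_measurable M01"
          using intm[of "\<Union>i. A i"] union by auto
        show "(\<lambda>x. \<Sum>i<n. indicator (A i) x * f x) \<in> borel_measurable M01" for n
          using intm union by (intro borel_measurable_sum) auto
        have sum_eq: "(\<Sum>i<n. indicator (A i) x) = (indicator (\<Union>i<n. A i) x :: real)" for n x
          using union.hyps(1) by (simp add: indicator_UN_disjoint disjoint_family_on_mono[of "{..<n}" UNIV])
        show "AE x in M01. (\<lambda>n. \<Sum>i<n. indicator (A i) x * f x) \<longlonglongrightarrow> indicator (\<Union>i. A i) x * f x"
          unfolding sum_distrib_right[symmetric] sum_eq
          by (intro AE_I2 tendsto_mult tendsto_const LIMSEQ_indicator_UN)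
        show "AE x in M01. norm (\<Sum>i<n. indicator (A i) x * f x) \<le> \<bar>f x\<bar>" for n
          unfolding sum_distrib_right[symmetric] sum_eq
          by (rule AE_I2) (simp add: indicator_def)
      qed (use int in auto)
      moreover have "(LINT x|M01. (\<Sum>i<n. indicator (A i) x * f x)) = 0" for n
        using union intm by (subst Bochner_Integration.integral_sum) auto
      ultimately show ?case by (simp only: LIMSEQ_const_iff)
    qed simp
    fix A assume "A \<in> sets M01"
    then have "A \<in> sets lebesgue" by (auto simp: sets_restrict_space)
    then obtain S N N' where A: "A = S \<union> N" "N \<subseteq> N'" "N' \<in> null_sets lborel" "S \<in> sets lborel"
      by (rule sets_completionE)
    have "AE x in M01. x \<notin> N'" using A(3) by (intro null null_sets_completionI)
    then have "(LINT x|M01. indicator A x * f x) = (LINT x|M01. indicator S x * f x)"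
    proof (intro integral_cong_AE)
      show "(\<lambda>x. indicator A x * f x) \<in> borel_measurable M01"
        using \<open>A \<in> sets M01\<close> by measurable
      show "(\<lambda>x. indicator S x * f x) \<in> borel_measurable M01"
        using intm[of S] A by auto
    qed (use A in \<open>auto simp: indicator_def elim!: AE_mp\<close>)
    then show "(LINT x:A|M01. f x) = 0"
      using borel[of S] A by (simp add: set_lebesgue_integral_def)
  qed
qed

section \<open>The lemma of du Bois-Reymond\<close>

lemma test_function_antiderivative:
  assumes \<psi>: "test_function \<psi>" and 0: "(LINT x|M01. \<psi> x) = 0"
  obtains \<phi> where "test_function \<phi>" "deriv \<phi> = \<psi>"
proof -
  obtain c d where cd: "0 < c" "c < d" "d < 1" "\<And>x. x \<notin> {c..d} \<Longrightarrow> \<psi> x = 0"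
    using test_function_support[OF \<psi>] by metis
  have cont: "continuous_on S \<psi>" for S
    using test_function_iterated_deriv_continuous[OF \<psi>, of S 0] by simp
  define \<phi> where "\<phi> x = integral {0..x} \<psi>" for x
  have left: "\<phi> x = 0" if "x < c" for x
  proof -
    have "integral {0..x} \<psi> = integral {0..x} (\<lambda>_. 0)"
      using that by (intro Henstock_Kurzweil_Integration.integral_cong cd) auto
    then show ?thesis by (simp add: \<phi>_def)
  qed
  \<comment> \<open>The primitive starts at 0, so its usual derivative formula covers only
    \<open>x > 0\<close>. Points left of \<open>c\<close> are treated by local constancy
    instead.\<close>
  have der: "(\<phi> has_real_derivative \<psi> x) (at x)" for x
  proof (cases "x < c")
    case True
    have "((\<lambda>x. 0) has_real_derivative 0) (at x)" by simp
    then have "(\<phi> has_real_derivative 0) (at x)"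
      by (rule has_field_derivative_transform_within_open[where S = "{..<c}"])
        (use left True in auto)
    then show ?thesis using cd(4)[of x] True by simp
  next
    case False
    then have x: "x \<in> {0<..<x + 1}" using cd by auto
    then have "(\<phi> has_real_derivative \<psi> x) (at x within {0..x + 1})"
      unfolding \<phi>_def by (intro integral_has_real_derivative cont) auto
    then have "(\<phi> has_real_derivative \<psi> x) (at x within {0<..<x + 1})"
      by (rule DERIV_subset) auto
    then show ?thesis using at_within_open[OF x] by simp
  qed
  \<comment> \<open>Beyond the support of \<open>\<psi>\<close> the primitive equals the full
    integral, which is zero by hypothesis. This is what makes \<open>\<phi>\<close> compactly
    supported.\<close>
  have right: "\<phi> x = 0" if "x > d" for x
  proof -
    have "(\<psi> has_integral 0) {0<..<1}"
      using has_integral_integral_lebesgue_on[of "{0<..<1}" \<psi>] 0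
        integrable_M01_if_square_integrable[OF test_function_square_integrable[OF \<psi>]] by simp
    moreover have "(\<lambda>x. if x \<in> {0<..<1} then \<psi> x else 0) = \<psi>"
      using cd by (auto simp: fun_eq_iff)
    ultimately have "(\<psi> has_integral 0) UNIV"
      using has_integral_restrict_UNIV[of "{0<..<1}" \<psi> 0] by simp
    moreover have "(\<lambda>y. if y \<in> {0..x} then \<psi> y else 0) = \<psi>"
      using cd that by (auto simp: fun_eq_iff)
    ultimately have "(\<psi> has_integral 0) {0..x}"
      using has_integral_restrict_UNIV[of "{0..x}" \<psi> 0] by simp
    then show ?thesis by (simp add: \<phi>_def integral_unique)
  qed
  have "deriv \<phi> = \<psi>" using der by (auto intro: DERIV_imp_deriv)
  moreover have "test_function \<phi>"
    unfolding test_function_def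
  proof (intro conjI allI)
    fix k x
    show "(deriv ^^ k) \<phi> field_differentiable at x"
    proof (cases k)
      case 0
      then show ?thesis using der by (auto simp: field_differentiable_def)
    next
      case (Suc l)
      then have "(deriv ^^ k) \<phi> = (deriv ^^ l) \<psi>"
        using \<open>deriv \<phi> = \<psi>\<close> by (simp add: funpow_swap1)
      then show ?thesis using \<psi> by (simp add: test_function_def)
    qed
  next
    have "\<phi> x = 0" if "x \<notin> {c..d}" for x
      using left[of x] right[of x] that by fastforce
    then show "\<exists>K. compact K \<and> K \<subseteq> {0<..<1} \<and> (\<forall>x. x \<notin> K \<longrightarrow> \<phi> x = 0)"
      using cd by (intro exI[of _ "{c..d}"]) auto
  qed
  ultimately show thesis using that by blast
qed

text \<open>Fix a test function \<open>\<eta>\<close> with nonzero integral. Subtracting a suitable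
  multiple of \<open>\<eta>\<close> from any \<open>\<phi>\<close> leaves mean zero, hence the
  derivative of a test function, against which \<open>w\<close> vanishes. So
  \<open>w - \<kappa>\<close> is orthogonal to all \<open>\<phi>\<close>, where
  \<open>\<kappa>\<close> is the mean of \<open>w\<close> weighted by \<open>\<eta>\<close>.\<close>

lemma weak_deriv_zero_imp_const:
  assumes w: "square_integrable w"
    and 0: "\<And>\<phi>. test_function \<phi> \<Longrightarrow> (LINT x|M01. w x * deriv \<phi> x) = 0"
  obtains \<kappa> where "AE x in M01. w x = \<kappa>"
proof -
  \<comment> \<open>If every test function had integral zero, the fundamental lemma applied to the
    constant 1 would make (0,1) a null set.\<close>
  obtain \<eta> where \<eta>: "test_function \<eta>" "(LINT x|M01. \<eta> x) \<noteq> 0"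
  proof (rule ccontr)
    assume "\<not> thesis"
    with that have *: "(LINT x|M01. \<phi> x) = 0" if "test_function \<phi>" for \<phi> using that by blast
    have "AE x in M01. (1::real) = 0"
      by (rule test_function_orthogonal_imp_AE_0) (simp_all add: square_integrable_const *)
    moreover have *: "{x. 0 < x \<and> x < 1} = {0<..<1::real}" by auto
    ultimately have "emeasure M01 {x \<in> space M01. True} = 0"
      by (subst (asm) AE_iff_measurable[OF sets.top]) (auto simp: *)
    then show False using emeasure_M01(1) by (simp add: *)
  qed
  define \<kappa> where "\<kappa> = (LINT x|M01. w x * \<eta> x) / (LINT x|M01. \<eta> x)"
  have "AE x in M01. w x - \<kappa> = 0"
  proof (rule test_function_orthogonal_imp_AE_0)
    show "square_integrable (\<lambda>x. w x - \<kappa>)"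
      by (intro square_integrable_diff w square_integrable_const)
    fix \<phi> assume \<phi>: "test_function \<phi>"
    define r where "r = (LINT x|M01. \<phi> x) / (LINT x|M01. \<eta> x)"
    have int: "integrable M01 \<phi>" "integrable M01 \<eta>" "integrable M01 (\<lambda>x. w x * \<phi> x)" "integrable M01 (\<lambda>x. w x * \<eta> x)"
      using \<phi> \<eta> w by (auto intro: integrable_M01_if_square_integrable square_integrable_mult
          test_function_square_integrable)
    have "(LINT x|M01. \<phi> x - r * \<eta> x) = 0"
      using int \<eta> by (simp add: r_def)
    then obtain \<Phi> where \<Phi>: "test_function \<Phi>" "deriv \<Phi> = (\<lambda>x. \<phi> x - r * \<eta> x)"
      using test_function_antiderivative[OF test_function_diff_scale[OF \<phi> \<eta>(1)]] by metis
    have "(LINT x|M01. w x * \<phi> x - r * (w x * \<eta> x)) = 0"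
      using 0[OF \<Phi>(1)] unfolding \<Phi>(2) by (simp add: algebra_simps)
    then have "(LINT x|M01. w x * \<phi> x) = r * (LINT x|M01. w x * \<eta> x)"
      using int by simp
    also have "\<dots> = \<kappa> * (LINT x|M01. \<phi> x)" by (simp add: r_def \<kappa>_def)
    finally show "(LINT x|M01. (w x - \<kappa>) * \<phi> x) = 0"
      using int by (simp add: left_diff_distrib)
  qed
  then show thesis using that[of \<kappa>] by simp
qed

text \<open>The fundamental theorem of calculus on \<open>[y, 1]\<close>, where
  \<open>\<phi> 1 = 0\<close>. It evaluates the inner integral once Fubini has been applied to a
  primitive.\<close>

lemma integral_deriv_test_function:
  assumes \<phi>: "test_function \<phi>" and y: "0 \<le> y" "y \<le> 1"
  shows "(LINT x|M01. indicator {y<..} x * deriv \<phi> x) = - \<phi> y"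
proof -
  let ?f = "\<lambda>x. indicator {y<..} x * deriv \<phi> x"
  have "\<phi> 1 = 0" using \<phi> unfolding test_function_def by force
  have "(deriv \<phi> has_integral \<phi> 1 - \<phi> y) {y..1}"
    using y by (intro fundamental_theorem_of_calculus)
      (auto simp flip: has_real_derivative_iff_has_vector_derivative
        intro: has_field_derivative_at_within test_function_has_deriv[OF \<phi>])
  then have "((\<lambda>x. if x \<in> {y..1} then deriv \<phi> x else 0) has_integral - \<phi> y) {0..1}"
    using y \<open>\<phi> 1 = 0\<close> by (subst has_integral_restrict) auto
  then have "(?f has_integral - \<phi> y) {0..1}"
    by (rule has_integral_spike_finite[of "{y}", rotated -1]) (auto simp: indicator_def)
  then have 1: "(?f has_integral - \<phi> y) {0<..<1}"
    by (simp add: has_integral_Icc_iff_Ioo)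
  have "integrable M01 ?f"
  proof (rule Bochner_Integration.integrable_bound)
    show "integrable M01 (deriv \<phi>)"
      using \<phi> by (intro integrable_M01_if_square_integrable test_function_square_integrable test_function_deriv)
    then have [measurable]: "deriv \<phi> \<in> borel_measurable M01" by simp
    have [measurable]: "indicator {y<..} \<in> borel_measurable M01"
      by (intro measurable_restrict_space1 borel_measurable_indicator) simp
    show "?f \<in> borel_measurable M01" by simp
  qed (auto simp: indicator_def)
  then have "(?f has_integral (LINT x|M01. ?f x)) {0<..<1}"
    by (rule has_integral_integral_lebesgue_on) simp
  then show ?thesis using 1 by (rule has_integral_unique)
qed

section \<open>Weak derivatives and the Poincare inequality\<close>

lemma indicator_borel_measurable_M01:
  "A \<in> sets borel \<Longrightarrow> (indicator A :: real \<Rightarrow> real) \<in> borel_measurable M01"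
  by (intro measurable_restrict_space1 borel_measurable_indicator) simp

text \<open>\<open>G\<close> is the primitive vanishing at 0. Writing it as an integral over all of
  (0,1) with an indicator lets Fubini exchange the integrals when \<open>G\<close> is tested with
  \<open>deriv \<phi>\<close>.\<close>

lemma primitive_props:
  fixes g :: "real \<Rightarrow> real"
  assumes g: "square_integrable g"
  defines "G \<equiv> \<lambda>x. LINT y|M01. indicator {..<x} y * g y"
  shows square_integrable_primitive: "square_integrable G"
    and integral_primitive_le: "(LINT x|M01. (G x)\<^sup>2) \<le> (LINT x|M01. (g x)\<^sup>2)"
    and has_weak_deriv_primitive:
      "test_function \<phi> \<Longrightarrow> (LINT x|M01. G x * deriv \<phi> x) = - (LINT x|M01. g x * \<phi> x)"
proof -
  interpret F: finite_measure M01 by (rule finite_measure_M01)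
  interpret pair_sigma_finite M01 M01 ..
  have [measurable]: "g \<in> borel_measurable M01" using g by (simp add: square_integrable_def)
  have [measurable]: "(\<lambda>x. x) \<in> borel_measurable M01"
    by (intro measurable_restrict_space1 measurable_completion) simp
  have [measurable]: "(\<lambda>z. indicator {..<fst z} (snd z) :: real) \<in> borel_measurable (M01 \<Otimes>\<^sub>M M01)"
  proof -
    have "(\<lambda>z. if snd z < fst z then 1 else 0 :: real) \<in> borel_measurable (M01 \<Otimes>\<^sub>M M01)"
      by measurable
    then show ?thesis by (simp add: indicator_def)
  qed
  have sq: "square_integrable (\<lambda>y. indicator {..<x} y * g y)" for x
    by (rule square_integrable_bounded_mult[where C = 1])
      (auto simp: indicator_borel_measurable_M01 g indicator_def)
  have Gm [measurable]: "G \<in> borel_measurable M01"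
  proof -
    have "(\<lambda>(x, y). indicator {..<x} y * g y) \<in> borel_measurable (M01 \<Otimes>\<^sub>M M01)"
      by (subst case_prod_beta') measurable
    from F.borel_measurable_lebesgue_integral[OF this] show ?thesis by (simp add: G_def)
  qed
  have G_bound: "(G x)\<^sup>2 \<le> (LINT y|M01. (g y)\<^sup>2)" for x
  proof -
    let ?h = "\<lambda>y. indicator {..<x} y * g y"
    have int: "integrable M01 ?h" "integrable M01 (\<lambda>y. (?h y)\<^sup>2)"
      using sq[of x] by (auto simp: integrable_M01_if_square_integrable) (auto simp: square_integrable_def)
    \<comment> \<open>On a space of total mass 1, \<open>G x\<close> is the mean of
      \<open>?h\<close>, and nonnegativity of the variance takes the place of
      Cauchy-Schwarz.\<close>
    have "0 \<le> (LINT y|M01. (?h y - G x)\<^sup>2)" by simp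
    also have "\<dots> = (LINT y|M01. (?h y)\<^sup>2 - 2 * G x * ?h y + (G x)\<^sup>2)"
      by (simp add: power2_diff algebra_simps)
    also have "\<dots> = (LINT y|M01. (?h y)\<^sup>2) - 2 * G x * (LINT y|M01. ?h y) + (G x)\<^sup>2"
      using int emeasure_M01(2) by simp
    also have "(LINT y|M01. ?h y) = G x" by (simp add: G_def)
    finally have "(G x)\<^sup>2 \<le> (LINT y|M01. (?h y)\<^sup>2)" by (simp add: power2_eq_square)
    also have "\<dots> \<le> (LINT y|M01. (g y)\<^sup>2)"
      using g by (intro integral_mono int) (auto simp: square_integrable_def indicator_def)
    finally show ?thesis .
  qed
  have int_sq: "integrable M01 (\<lambda>x. (G x)\<^sup>2)"
    by (rule F.integrable_const_bound[where B = "LINT y|M01. (g y)\<^sup>2"]) (auto simp: G_bound)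
  then show "square_integrable G" by (simp add: square_integrable_def)
  have "(LINT x|M01. (G x)\<^sup>2) \<le> (LINT x|M01. (LINT y|M01. (g y)\<^sup>2))"
    using int_sq by (intro integral_mono G_bound) auto
  then show "(LINT x|M01. (G x)\<^sup>2) \<le> (LINT x|M01. (g x)\<^sup>2)"
    using emeasure_M01(2) by simp
  assume \<phi>: "test_function \<phi>"
  have [measurable]: "deriv \<phi> \<in> borel_measurable M01"
    using test_function_measurable[OF \<phi>, of 1] by simp
  obtain B where B: "0 \<le> B" "\<And>x. \<bar>deriv \<phi> x\<bar> \<le> B"
    using test_function_bounded[OF test_function_deriv[OF \<phi>]] by metis
  let ?F = "\<lambda>x y. indicator {..<x} y * g y * deriv \<phi> x"
  \<comment> \<open>A bound \<open>B\<close> on \<open>deriv \<phi>\<close> provides the integrable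
    majorant \<open>B |g(y)|\<close> for Fubini.\<close>
  have "integrable (M01 \<Otimes>\<^sub>M M01) (case_prod ?F)"
  proof (rule Bochner_Integration.integrable_bound)
    show "integrable (M01 \<Otimes>\<^sub>M M01) (\<lambda>z. B * g (snd z))"
    proof (rule Fubini_integrable)
      show "AE x in M01. integrable M01 (\<lambda>y. B * g (snd (x, y)))"
        using integrable_M01_if_square_integrable[OF g] by simp
    qed simp_all
    show "case_prod ?F \<in> borel_measurable (M01 \<Otimes>\<^sub>M M01)"
      by (subst case_prod_beta') measurable
    show "AE z in M01 \<Otimes>\<^sub>M M01. norm (case_prod ?F z) \<le> norm (B * g (snd z))"
      using B by (intro AE_I2) (auto simp: indicator_def abs_mult mult.commute[of B] intro!: mult_left_mono)
  qed
  then have "(LINT x|M01. LINT y|M01. ?F x y) = (LINT y|M01. LINT x|M01. ?F x y)"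
    by (rule Fubini_integral[symmetric])
  also have "(LINT x|M01. LINT y|M01. ?F x y) = (LINT x|M01. G x * deriv \<phi> x)"
    unfolding G_def by simp
  \<comment> \<open>Read as a condition on \<open>x\<close>, the indicator of \<open>y < x\<close>
    restricts the inner integral of \<open>deriv \<phi>\<close> to the part right of
    \<open>y\<close>.\<close>
  also have "(LINT y|M01. LINT x|M01. ?F x y) = (LINT y|M01. - (g y * \<phi> y))"
  proof (rule Bochner_Integration.integral_cong[OF refl])
    fix y assume "y \<in> space M01"
    then have "(LINT x|M01. indicator {y<..} x * deriv \<phi> x) = - \<phi> y"
      by (intro integral_deriv_test_function[OF \<phi>]) (auto simp: space_restrict_space)
    moreover have "(LINT x|M01. ?F x y) = (LINT x|M01. g y * (indicator {y<..} x * deriv \<phi> x))"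
      by (intro Bochner_Integration.integral_cong) (auto simp: indicator_def)
    ultimately show "(LINT x|M01. ?F x y) = - (g y * \<phi> y)" by simp
  qed
  finally show "(LINT x|M01. G x * deriv \<phi> x) = - (LINT x|M01. g x * \<phi> x)" by simp
qed

section \<open>Uniqueness and linearity of the weak derivative\<close>

lemma has_weak_deriv_unique:
  assumes "has_weak_deriv u g" "has_weak_deriv u h"
  shows "g = h"
  using assms
proof (transfer, goal_cases)
  case (1 u g h)
  then have g: "square_integrable g" and h: "square_integrable h" by (auto simp: L2_eq_def)
  have "AE x in M01. g x - h x = 0"
  proof (rule test_function_orthogonal_imp_AE_0)
    fix \<phi> assume "test_function \<phi>"
    then show "(LINT x|M01. (g x - h x) * \<phi> x) = 0"
      using 1 square_integrable_mult[OF g test_function_square_integrable, of \<phi>]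
        square_integrable_mult[OF h test_function_square_integrable, of \<phi>]
      by (auto simp: left_diff_distrib)
  qed (intro square_integrable_diff g h)
  then show ?case using g h by (simp add: L2_eq_def)
qed

lemma weak_deriv_eqI: "has_weak_deriv u g \<Longrightarrow> weak_deriv u = g"
  unfolding weak_deriv_def by (blast intro: has_weak_deriv_unique)

lemma has_weak_deriv_weak_deriv: "u \<in> H1 \<Longrightarrow> has_weak_deriv u (weak_deriv u)"
  by (auto simp: H1_def weak_deriv_eqI)

lemma has_weak_deriv_add:
  "has_weak_deriv u g \<Longrightarrow> has_weak_deriv v h \<Longrightarrow> has_weak_deriv (u + v) (g + h)"
proof (transfer, intro allI impI, goal_cases)
  case (1 u g v h \<phi>)
  then show ?case
    by (simp add: distrib_right L2_eq_def square_integrable_mult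
        test_function_deriv test_function_square_integrable)
qed

lemma has_weak_deriv_scaleR: "has_weak_deriv u g \<Longrightarrow> has_weak_deriv (c *\<^sub>R u) (c *\<^sub>R g)"
  by transfer (simp add: mult.assoc)

lemma weak_deriv_add: "u \<in> H1 \<Longrightarrow> v \<in> H1 \<Longrightarrow> weak_deriv (u + v) = weak_deriv u + weak_deriv v"
  by (intro weak_deriv_eqI has_weak_deriv_add has_weak_deriv_weak_deriv)

lemma weak_deriv_scaleR: "u \<in> H1 \<Longrightarrow> weak_deriv (c *\<^sub>R u) = c *\<^sub>R weak_deriv u"
  by (intro weak_deriv_eqI has_weak_deriv_scaleR has_weak_deriv_weak_deriv)

lemma weak_deriv_const: "weak_deriv (const_L2 c) = 0"
proof (rule weak_deriv_eqI, transfer, intro allI impI)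
  fix c :: real and \<phi> assume \<phi>: "test_function \<phi>"
  have "(LINT x|M01. deriv \<phi> x) = (LINT x|M01. indicator {0<..} x * deriv \<phi> x)"
    by (intro Bochner_Integration.integral_cong) (auto simp: space_restrict_space)
  also have "\<dots> = 0"
    using integral_deriv_test_function[OF \<phi>, of 0] \<phi> by (force simp: test_function_def)
  finally show "(LINT x|M01. c * deriv \<phi> x) = - (LINT x|M01. 0 * \<phi> x)" by simp
qed

section \<open>The Poincare inequality\<close>

lemma inner_const_L2_1: "inner (const_L2 1) (const_L2 1) = 1"
  by transfer (use emeasure_M01(2) in simp)

text \<open>The difference of \<open>u\<close> and the primitive \<open>G\<close> of
  \<open>g\<close> has weak derivative zero, hence is a constant \<open>\<kappa>\<close>. Thus
  \<open>u - \<kappa>\<close> is \<open>G\<close> almost everywhere, and the norm of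
  \<open>G\<close> is at most that of \<open>g\<close>.\<close>

lemma has_weak_deriv_dist_const:
  assumes "has_weak_deriv u g"
  shows "\<exists>\<kappa>. inner (u - const_L2 \<kappa>) (u - const_L2 \<kappa>) \<le> inner g g"
  using assms
proof (transfer, goal_cases)
  case (1 u g)
  then have u: "square_integrable u" and g: "square_integrable g" by (auto simp: L2_eq_def)
  define G where "G = (\<lambda>x. LINT y|M01. indicator {..<x} y * g y)"
  have G: "square_integrable G" unfolding G_def by (rule square_integrable_primitive[OF g])
  obtain \<kappa> where \<kappa>: "AE x in M01. u x - G x = \<kappa>"
  proof (rule weak_deriv_zero_imp_const)
    show "square_integrable (\<lambda>x. u x - G x)" by (intro square_integrable_diff u G)
    fix \<phi> assume \<phi>: "test_function \<phi>"
    have "(LINT x|M01. u x * deriv \<phi> x) = (LINT x|M01. G x * deriv \<phi> x)"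
      using 1 \<phi> has_weak_deriv_primitive[OF g \<phi>] by (simp add: G_def)
    then show "(LINT x|M01. (u x - G x) * deriv \<phi> x) = 0"
      using square_integrable_mult[OF u, of "deriv \<phi>"] square_integrable_mult[OF G, of "deriv \<phi>"] \<phi>
      by (simp add: left_diff_distrib test_function_square_integrable test_function_deriv)
  qed
  have "(LINT x|M01. (u x - \<kappa>) * (u x - \<kappa>)) = (LINT x|M01. (G x)\<^sup>2)"
    using \<kappa> u G
    by (intro integral_cong_AE) (auto simp: square_integrable_def power2_eq_square elim!: AE_mp)
  also have "\<dots> \<le> (LINT x|M01. g x * g x)"
    using integral_primitive_le[OF g] by (simp add: G_def power2_eq_square)
  finally show ?case by blast
qed

lemma const_L2_scaleR: "const_L2 c = c *\<^sub>R const_L2 1"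
  by transfer (simp add: L2_eq_def square_integrable_const)

lemma poincare:
  assumes "u \<in> H1"
  shows "norm (u - inner u (const_L2 1) *\<^sub>R const_L2 1) \<le> norm (weak_deriv u)"
proof -
  obtain \<kappa> where \<kappa>: "inner (u - \<kappa> *\<^sub>R const_L2 1) (u - \<kappa> *\<^sub>R const_L2 1) \<le> inner (weak_deriv u) (weak_deriv u)"
    using has_weak_deriv_dist_const[OF has_weak_deriv_weak_deriv[OF assms]]
    by (subst (asm) (1 2) const_L2_scaleR) blast
  let ?m = "inner u (const_L2 1)"
  \<comment> \<open>Pythagoras: the mean \<open>?m\<close> is the best constant approximation of
    \<open>u\<close>, so it may replace the unknown \<open>\<kappa>\<close>.\<close>
  have "inner (u - ?m *\<^sub>R const_L2 1) (u - ?m *\<^sub>R const_L2 1) + (\<kappa> - ?m)\<^sup>2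
     = inner (u - \<kappa> *\<^sub>R const_L2 1) (u - \<kappa> *\<^sub>R const_L2 1)"
    by (simp add: inner_diff inner_const_L2_1 inner_commute[of "const_L2 1" u])
      (simp add: power2_eq_square algebra_simps)
  then show ?thesis using \<kappa> zero_le_power2[of "\<kappa> - ?m"] unfolding norm_le by linarith
qed

section \<open>Multiplication by the damping coefficient\<close>

lemma coeff_mult_bounds:
  assumes "a \<in> borel_measurable M01" "\<forall>x\<in>{0<..<1}. a0 \<le> a x \<and> a x \<le> a1" "0 < a0"
  shows coeff_mult_ge: "a0 * inner f f \<le> inner (coeff_mult a f) f"
    and coeff_mult_le: "inner (coeff_mult a f) (coeff_mult a f) \<le> a1 * inner (coeff_mult a f) f"
    and coeff_mult_linear: "coeff_mult a (f + g) = coeff_mult a f + coeff_mult a g"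
       "coeff_mult a (c *\<^sub>R f) = c *\<^sub>R coeff_mult a f"
proof -
  have ex: "\<exists>C. \<forall>x\<in>{0<..<1}. \<bar>a x\<bar> \<le> C"
    using assms by (intro exI[of _ a1]) fastforce
  then obtain C where C: "\<forall>x\<in>{0<..<1}. \<bar>a x\<bar> \<le> C" by blast
  have [simp]: "square_integrable f \<Longrightarrow> square_integrable (\<lambda>x. a x * f x)" for f
    using assms(1) C by (rule square_integrable_bounded_mult)
  \<comment> \<open>The bounds on \<open>a\<close> select the genuine branch of
    \<open>coeff_mult\<close>, so its dummy value never occurs.\<close>
  have if_True: "(if a \<in> borel_measurable M01 \<and> (\<exists>C. \<forall>x\<in>{0<..<1}. \<bar>a x\<bar> \<le> C)
         then (\<lambda>x. a x * f x) else (\<lambda>x. 0)) = (\<lambda>x. a x * f x)" for f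
    using assms(1) ex by simp
  show "a0 * inner f f \<le> inner (coeff_mult a f) f"
  proof (transfer fixing: a a0, unfold if_True, goal_cases)
    case (1 f)
    have *: "a0 * (f x * f x) \<le> a x * f x * f x" if "x \<in> space M01" for x
      unfolding mult.assoc[of "a x"] using assms(2) that
      by (intro mult_right_mono) (auto simp: space_restrict_space)
    have "(LINT x|M01. a0 * (f x * f x)) \<le> (LINT x|M01. a x * f x * f x)"
      using 1 * by (intro integral_mono)
        (auto simp: L2_eq_def intro!: square_integrable_mult integrable_mult_right)
    then show ?case by simp
  qed
  \<comment> \<open>From \<open>a^2 \<le> a1 a\<close> pointwise: the size of \<open>a f\<close> is
    controlled by the dissipation \<open>(a f, f)\<close> itself, as the estimate of the cross term
    requires.\<close>
  show "inner (coeff_mult a f) (coeff_mult a f) \<le> a1 * inner (coeff_mult a f) f"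
  proof (transfer fixing: a a1, unfold if_True, goal_cases)
    case (1 f)
    have *: "a x * f x * (a x * f x) \<le> a1 * (a x * f x * f x)" if "x \<in> space M01" for x
    proof -
      have "a x * (a x * (f x * f x)) \<le> a1 * (a x * (f x * f x))"
        using that assms(2,3)
        by (intro mult_right_mono mult_nonneg_nonneg[OF _ zero_le_square])
          (auto simp: space_restrict_space intro: order_trans[OF less_imp_le])
      then show ?thesis by (simp add: ac_simps)
    qed
    have "(LINT x|M01. a x * f x * (a x * f x)) \<le> (LINT x|M01. a1 * (a x * f x * f x))"
      using 1 * by (intro integral_mono)
        (auto simp: L2_eq_def intro!: square_integrable_mult integrable_mult_right)
    then show ?case by simp
  qed
  show "coeff_mult a (f + g) = coeff_mult a f + coeff_mult a g"
    by (transfer fixing: a, unfold if_True)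
      (auto simp: L2_eq_def distrib_left square_integrable_add)
  show "coeff_mult a (c *\<^sub>R f) = c *\<^sub>R coeff_mult a f"
    by (transfer fixing: a, unfold if_True)
      (auto simp: L2_eq_def mult.left_commute square_integrable_scale)
qed

section \<open>Difference quotients of solutions\<close>

text \<open>The scheme at a single time level and without initial values, since quotients of order
  \<open>k\<close> start from other data and satisfy the equations only for
  \<open>n > k\<close>.\<close>

definition theta_step ::
  "real \<Rightarrow> real \<Rightarrow> (real \<Rightarrow> real) \<Rightarrow> L2 set \<Rightarrow> L2 set \<Rightarrow> (nat \<Rightarrow> L2) \<Rightarrow> (nat \<Rightarrow> L2) \<Rightarrow> nat \<Rightarrow> bool" where
  "theta_step \<theta> \<tau> a V Q u p n \<longleftrightarrow>
     (\<forall>v\<in>V. inner (bdq \<tau> 1 u n) v - inner (theta_avg \<theta> p n) (weak_deriv v)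
              + inner (coeff_mult a (theta_avg \<theta> u n)) v = 0) \<and>
     (\<forall>q\<in>Q. inner (bdq \<tau> 1 p n) q + inner (weak_deriv (theta_avg \<theta> u n)) q = 0)"

lemma bdq_in_subspace: "subspace V \<Longrightarrow> (\<And>n. w n \<in> V) \<Longrightarrow> bdq \<tau> k w n \<in> V"
  by (induction k arbitrary: n) (auto intro: subspace_diff subspace_scale)

lemma theta_avg_in_subspace: "subspace V \<Longrightarrow> (\<And>n. w n \<in> V) \<Longrightarrow> theta_avg \<theta> w n \<in> V"
  by (auto simp: theta_avg_def intro: subspace_add subspace_scale)

lemma bdq_1_bdq_Suc:
  "bdq \<tau> 1 (bdq \<tau> (Suc k) w) n = (1 / \<tau>) *\<^sub>R (bdq \<tau> 1 (bdq \<tau> k w) n - bdq \<tau> 1 (bdq \<tau> k w) (n - 1))"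
  by simp

lemma theta_avg_bdq_Suc:
  "theta_avg \<theta> (bdq \<tau> (Suc k) w) n = (1 / \<tau>) *\<^sub>R (theta_avg \<theta> (bdq \<tau> k w) n - theta_avg \<theta> (bdq \<tau> k w) (n - 1))"
  by (simp add: theta_avg_def scaleR_add_right scaleR_diff_right scaleR_left_commute[of \<theta>]
      scaleR_left_commute[of "1 - \<theta>"] add_diff_add)

text \<open>The scheme is linear with time-independent coefficients, so subtracting the equations at
  \<open>n - 1\<close> from those at \<open>n\<close> and dividing by \<open>\<tau>\<close> gives
  the equations for the next quotient. Both levels must be admissible for order \<open>k\<close>,
  hence \<open>Suc k < n\<close> in the induction step.\<close>

lemma theta_step_bdq:
  assumes "\<And>n. 1 \<le> n \<Longrightarrow> theta_step \<theta> \<tau> a V Q u p n"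
    and V: "subspace V" "V \<subseteq> H1" "\<And>n. u n \<in> V"
    and a: "a \<in> borel_measurable M01" "\<forall>x\<in>{0<..<1}. a0 \<le> a x \<and> a x \<le> a1" "0 < a0"
  shows "k < n \<Longrightarrow> theta_step \<theta> \<tau> a V Q (bdq \<tau> k u) (bdq \<tau> k p) n"
proof (induction k arbitrary: n)
  case 0
  have "bdq \<tau> 0 w = w" for w by (simp add: fun_eq_iff)
  then show ?case using assms(1)[of n] 0 by simp
next
  case (Suc k)
  then have *: "theta_step \<theta> \<tau> a V Q (bdq \<tau> k u) (bdq \<tau> k p) n"
     "theta_step \<theta> \<tau> a V Q (bdq \<tau> k u) (bdq \<tau> k p) (n - 1)" by simp_all
  let ?U = "theta_avg \<theta> (bdq \<tau> k u) n" and ?U' = "theta_avg \<theta> (bdq \<tau> k u) (n - 1)"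
  have "?U \<in> V" "?U' \<in> V"
    by (intro theta_avg_in_subspace bdq_in_subspace V)+
  then have H: "?U \<in> H1" "?U' \<in> H1" "?U - ?U' \<in> H1" "(- 1) *\<^sub>R ?U' \<in> H1"
    using V subspace_diff[OF V(1)] subspace_scale[OF V(1)] by blast+
  have D: "weak_deriv ((1 / \<tau>) *\<^sub>R (?U - ?U')) = (1 / \<tau>) *\<^sub>R (weak_deriv ?U - weak_deriv ?U')"
    using weak_deriv_scaleR[OF H(3), of "1 / \<tau>"] weak_deriv_add[OF H(1,4)]
      weak_deriv_scaleR[OF H(2), of "- 1"] by simp
  have A: "coeff_mult a ((1 / \<tau>) *\<^sub>R (?U - ?U')) = (1 / \<tau>) *\<^sub>R (coeff_mult a ?U - coeff_mult a ?U')"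
    using coeff_mult_linear(1)[OF a, of ?U "- 1 *\<^sub>R ?U'"] coeff_mult_linear(2)[OF a, of "- 1" ?U']
      coeff_mult_linear(2)[OF a, of "1 / \<tau>" "?U - ?U'"] by simp
  show ?case
    unfolding theta_step_def bdq_1_bdq_Suc theta_avg_bdq_Suc D A
  proof (intro conjI ballI)
    fix v assume "v \<in> V"
    let ?b = "bdq \<tau> 1 (bdq \<tau> k u)" and ?P = "theta_avg \<theta> (bdq \<tau> k p)"
    have "inner ((1 / \<tau>) *\<^sub>R (?b n - ?b (n - 1))) v
        - inner ((1 / \<tau>) *\<^sub>R (?P n - ?P (n - 1))) (weak_deriv v)
        + inner ((1 / \<tau>) *\<^sub>R (coeff_mult a ?U - coeff_mult a ?U')) v
      = (1 / \<tau>) * ((inner (?b n) v - inner (?P n) (weak_deriv v) + inner (coeff_mult a ?U) v)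
          - (inner (?b (n - 1)) v - inner (?P (n - 1)) (weak_deriv v) + inner (coeff_mult a ?U') v))"
      by (simp only: inner_scaleR_left inner_diff_left ring_distribs)
    also have "\<dots> = 0"
      using * \<open>v \<in> V\<close> unfolding theta_step_def by (simp del: bdq.simps)
    finally show "inner ((1 / \<tau>) *\<^sub>R (?b n - ?b (n - 1))) v
        - inner ((1 / \<tau>) *\<^sub>R (?P n - ?P (n - 1))) (weak_deriv v)
        + inner ((1 / \<tau>) *\<^sub>R (coeff_mult a ?U - coeff_mult a ?U')) v = 0" .
  next
    fix q assume "q \<in> Q"
    let ?b = "bdq \<tau> 1 (bdq \<tau> k p)"
    have "inner ((1 / \<tau>) *\<^sub>R (?b n - ?b (n - 1))) q
        + inner ((1 / \<tau>) *\<^sub>R (weak_deriv ?U - weak_deriv ?U')) q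
      = (1 / \<tau>) * ((inner (?b n) q + inner (weak_deriv ?U) q)
          - (inner (?b (n - 1)) q + inner (weak_deriv ?U') q))"
      by (simp only: inner_scaleR_left inner_diff_left ring_distribs)
    also have "\<dots> = 0"
      using * \<open>q \<in> Q\<close> unfolding theta_step_def by (simp del: bdq.simps)
    finally show "inner ((1 / \<tau>) *\<^sub>R (?b n - ?b (n - 1))) q
        + inner ((1 / \<tau>) *\<^sub>R (weak_deriv ?U - weak_deriv ?U')) q = 0" .
  qed
qed

section \<open>The discrete Lyapunov functional\<close>

definition lyapunov :: "real \<Rightarrow> 'a::real_inner \<Rightarrow> 'a \<Rightarrow> 'a \<Rightarrow> real" where
  "lyapunov \<epsilon> u p r = 1 / 2 * (inner u u + inner p p) - \<epsilon> * inner u r"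

lemma double_inner_le: "2 * \<bar>inner x y\<bar> \<le> inner x x + inner y y" for x y :: "'a::real_inner"
  using inner_ge_zero[of "x - y"] inner_ge_zero[of "x + y"]
  by (simp add: inner_diff inner_add inner_commute[of y x])

text \<open>The cross term is at most \<open>\<epsilon>/2\<close>, hence 1/8, times
  \<open>(u, u) + (p, p)\<close>; the constants are \<open>1/2 - 1/8\<close> and
  \<open>1/2 + 1/8\<close>.\<close>

lemma lyapunov_bounds:
  fixes u p r :: "'a::real_inner"
  assumes "inner r r \<le> inner p p" "0 \<le> \<epsilon>" "\<epsilon> \<le> 1 / 4"
  shows "3 / 8 * (inner u u + inner p p) \<le> lyapunov \<epsilon> u p r"
    and "lyapunov \<epsilon> u p r \<le> 5 / 8 * (inner u u + inner p p)"
proof -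
  have "2 * \<bar>inner u r\<bar> \<le> inner u u + inner p p"
    using double_inner_le[of u r] assms(1) by linarith
  then have "\<bar>\<epsilon> * inner u r\<bar> \<le> 1 / 4 * ((inner u u + inner p p) / 2)"
    unfolding abs_mult using assms by (intro mult_mono) auto
  then show "3 / 8 * (inner u u + inner p p) \<le> lyapunov \<epsilon> u p r"
    "lyapunov \<epsilon> u p r \<le> 5 / 8 * (inner u u + inner p p)"
    by (auto simp: lyapunov_def abs_le_iff field_simps)
qed

text \<open>Young's inequality with weight 1/11 on \<open>x\<close> and 11 on the shift. It recovers
  the energy at the old time level from that of the theta average, at a cost quadratic in the
  increment.\<close>

lemma inner_shift_bound:
  fixes x d :: "'a::real_inner"
  assumes "0 \<le> \<theta>" "\<theta> \<le> 1"
  shows "10 / 11 * inner x x - 10 * inner d d \<le> inner (x + \<theta> *\<^sub>R d) (x + \<theta> *\<^sub>R d)"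
proof -
  let ?y = "(1 / 11) *\<^sub>R x + \<theta> *\<^sub>R d"
  have "0 \<le> 11 * inner ?y ?y" by simp
  also have "\<dots> = 1 / 11 * inner x x + 2 * \<theta> * inner x d + 11 * (\<theta>\<^sup>2 * inner d d)"
    by (simp add: inner_add inner_commute[of d x] algebra_simps power2_eq_square)
  finally have "0 \<le> 1 / 11 * inner x x + 2 * \<theta> * inner x d + 11 * (\<theta>\<^sup>2 * inner d d)" .
  moreover have "\<theta>\<^sup>2 * inner d d \<le> inner d d"
    using assms by (intro mult_left_le_one_le) (auto simp: power_le_one)
  moreover have "inner (x + \<theta> *\<^sub>R d) (x + \<theta> *\<^sub>R d)
      = inner x x + 2 * \<theta> * inner x d + \<theta>\<^sup>2 * inner d d"
    by (simp add: inner_add inner_commute[of d x] algebra_simps power2_eq_square)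
  ultimately show ?thesis by simp
qed

text \<open>Here \<open>d\<close>, \<open>e\<close>, \<open>s\<close> are the increments of \<open>u\<close>, \<open>p\<close>, \<open>r\<close> over one time step, while \<open>A\<close> and \<open>D\<close>
  stand for \<open>a U\<close> and \<open>\<partial>\<^sub>xU\<close>.\<close>

lemma lyapunov_step:
  fixes u d p e r s A D :: "'a::real_inner" and \<theta> :: real
  defines "U \<equiv> u + \<theta> *\<^sub>R d" and "P \<equiv> p + \<theta> *\<^sub>R e" and "R \<equiv> r + \<theta> *\<^sub>R s"
  assumes eq1: "inner d U = \<tau> * inner P D - \<tau> * inner A U"
    and eq2: "inner d R = \<tau> * inner P P - \<tau> * inner A R"
    and eq3: "inner e P = - \<tau> * inner D P"
    and eq4: "inner s U \<ge> - \<tau> * inner U U"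
    and le: "inner r r \<le> inner p p" "inner R R \<le> inner P P" "inner s s \<le> inner e e"
    and A: "a0 * inner U U \<le> inner A U" "inner A A \<le> a1 * inner A U"
    and eps: "0 < \<epsilon>" "\<epsilon> \<le> 1 / 4" "8 * \<epsilon> \<le> a0" "4 * \<epsilon> * a1 \<le> 1"
    and \<theta>: "1 / 2 < \<theta>" "\<theta> \<le> 1" and \<tau>: "0 < \<tau>" "\<tau> \<le> (\<theta> - 1 / 2) / 2"
  shows "lyapunov \<epsilon> (u + d) (p + e) (r + s) \<le> (1 - 8 / 11 * (\<epsilon> * \<tau>)) * lyapunov \<epsilon> u p r"
proof -
  define S where "S = inner d d + inner e e"
  define N where "N = inner U U + inner P P"
  define E where "E = inner u u + inner p p"
  have S: "0 \<le> S" and UU: "0 \<le> inner U U" and PP: "0 \<le> inner P P" and E: "0 \<le> E"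
    by (simp_all add: S_def E_def)
  have "0 < a0" using eps by linarith
  then have AU: "0 \<le> inner A U" using A(1) UU by (meson mult_nonneg_nonneg less_imp_le order_trans)
  \<comment> \<open>Half the increment of \<open>(u, u)\<close> is
    \<open>(d, U) - (\<theta> - 1/2) (d, d)\<close>, and likewise for \<open>p\<close>; on adding
    the two equations the coupling terms \<open>(P, D)\<close> cancel.\<close>
  have en: "1 / 2 * (inner (u + d) (u + d) + inner (p + e) (p + e))
      = 1 / 2 * E - \<tau> * inner A U - (\<theta> - 1 / 2) * S"
    using eq1 eq3 unfolding U_def P_def E_def S_def
    by (simp add: inner_add inner_commute[of d u] inner_commute[of e p] inner_commute[of _ D] algebra_simps)
  have cross: "inner (u + d) (r + s) - inner u r = inner s U + inner d R - (2 * \<theta> - 1) * inner d s"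
    unfolding U_def R_def by (simp add: inner_add inner_commute[of s] algebra_simps)
  have AR: "2 * inner A R \<le> a1 * inner A U + inner P P"
    using double_inner_le[of A R] A(2) le(2) by linarith
  have ds: "2 * inner d s \<le> S"
    using double_inner_le[of d s] le(3) unfolding S_def by linarith
  have "\<epsilon> * inner A R \<le> 1 / 8 * inner A U + \<epsilon> / 2 * inner P P"
  proof -
    have "\<epsilon> * inner A R \<le> \<epsilon> * ((a1 * inner A U + inner P P) / 2)"
      using AR eps by (intro mult_left_mono) auto
    also have "\<dots> = 1 / 8 * (4 * \<epsilon> * a1 * inner A U) + \<epsilon> / 2 * inner P P"
      by (simp add: algebra_simps)
    also have "4 * \<epsilon> * a1 * inner A U \<le> 1 * inner A U"
      using eps AU by (intro mult_right_mono) auto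
    finally show ?thesis by simp
  qed
  moreover have eU: "\<epsilon> * inner U U \<le> 1 / 8 * inner A U"
  proof -
    have "8 * \<epsilon> * inner U U \<le> a0 * inner U U"
      using eps UU by (intro mult_right_mono) auto
    then show ?thesis using A(1) by linarith
  qed
  \<comment> \<open>One eighth of the damping \<open>(A, U)\<close> pays for the cross term and one
    eighth for \<open>\<epsilon> (U, U)\<close>. The remainder dominates
    \<open>\<epsilon>/2 (U, U)\<close>, and half of \<open>\<epsilon> (P, P)\<close>
    survives.\<close>
  ultimately have main: "- inner A U - \<epsilon> * inner P P + \<epsilon> * inner A R + \<epsilon> * inner U U \<le> - (\<epsilon> / 2) * N"
    using AU by (simp add: N_def algebra_simps)
  \<comment> \<open>The mixed increment uses at most a quarter of the numerical dissipation, because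
    \<open>\<epsilon> \<le> 1/4\<close>.\<close>
  have "(2 * \<theta> - 1) * \<epsilon> * inner d s \<le> (2 * \<theta> - 1) * \<epsilon> * (S / 2)"
    using ds eps \<theta> by (intro mult_left_mono) auto
  also have "\<dots> = (\<theta> - 1 / 2) * (\<epsilon> * S)" by (simp add: field_simps)
  also have "\<dots> \<le> (\<theta> - 1 / 2) * (1 / 4 * S)"
    using eps \<theta> S by (intro mult_left_mono mult_right_mono) auto
  finally have ds': "(2 * \<theta> - 1) * \<epsilon> * inner d s \<le> 1 / 4 * ((\<theta> - 1 / 2) * S)" by simp
  have N: "10 / 11 * E - 10 * S \<le> N"
    using inner_shift_bound[of \<theta> u d] inner_shift_bound[of \<theta> p e] \<theta>
    unfolding N_def E_def S_def U_def P_def by (simp add: algebra_simps)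
  have "lyapunov \<epsilon> (u + d) (p + e) (r + s) - lyapunov \<epsilon> u p r
    = - \<tau> * inner A U - (\<theta> - 1 / 2) * S - \<epsilon> * (inner s U + inner d R - (2 * \<theta> - 1) * inner d s)"
    unfolding lyapunov_def cross[symmetric] en by (simp add: E_def algebra_simps)
  also have "\<dots> = \<tau> * (- inner A U - \<epsilon> * inner P P + \<epsilon> * inner A R) - \<epsilon> * inner s U
      - (\<theta> - 1 / 2) * S + (2 * \<theta> - 1) * \<epsilon> * inner d s"
    unfolding eq2 by (simp add: algebra_simps)
  also have "\<dots> \<le> \<tau> * (- inner A U - \<epsilon> * inner P P + \<epsilon> * inner A R) + \<epsilon> * (\<tau> * inner U U)
      - 3 / 4 * ((\<theta> - 1 / 2) * S)"
    using mult_left_mono[OF eq4, of \<epsilon>] eps ds' by simp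
  also have "\<dots> = \<tau> * (- inner A U - \<epsilon> * inner P P + \<epsilon> * inner A R + \<epsilon> * inner U U)
      - 3 / 4 * ((\<theta> - 1 / 2) * S)"
    by (simp add: algebra_simps)
  also have "\<dots> \<le> \<tau> * (- (\<epsilon> / 2) * N) - 3 / 4 * ((\<theta> - 1 / 2) * S)"
    using mult_left_mono[OF main, of \<tau>] \<tau> by simp
  also have "\<dots> \<le> \<tau> * (- (\<epsilon> / 2) * (10 / 11 * E - 10 * S)) - 3 / 4 * ((\<theta> - 1 / 2) * S)"
    using mult_left_mono[OF N, of "\<tau> * \<epsilon>"] \<tau> eps by simp
  also have "\<dots> = - (5 / 11) * (\<epsilon> * \<tau> * E) + (5 * (\<epsilon> * \<tau>) - 3 / 4 * (\<theta> - 1 / 2)) * S"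
    by (simp add: field_simps)
  \<comment> \<open>The step restriction enters here: \<open>5 \<epsilon> \<tau> \<le> 5/4 \<tau>
    \<le> 5/8 (\<theta> - 1/2)\<close>, below the remaining 3/4 of the dissipation.\<close>
  also have "\<dots> \<le> - (5 / 11) * (\<epsilon> * \<tau> * E)"
  proof -
    have "\<epsilon> * \<tau> \<le> 1 / 4 * \<tau>" using eps \<tau> by (intro mult_right_mono) auto
    then have "5 * (\<epsilon> * \<tau>) - 3 / 4 * (\<theta> - 1 / 2) \<le> 0" using \<tau> \<theta> by argo
    then show ?thesis using mult_nonpos_nonneg[OF _ S] by simp
  qed
  \<comment> \<open>\<open>5/11 = 8/11 * 5/8\<close>, where 5/8 is the upper constant in
    \<open>lyapunov_bounds\<close>.\<close>
  also have "\<dots> \<le> - (8 / 11) * (\<epsilon> * \<tau> * lyapunov \<epsilon> u p r)"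
    using mult_left_mono[OF lyapunov_bounds(2)[OF le(1), of \<epsilon> u], of "\<epsilon> * \<tau>"] eps \<tau>
    by (simp add: E_def)
  finally show ?thesis by (simp add: algebra_simps)
qed

section \<open>One time step of the scheme\<close>

lemma inner_weak_deriv_ge:
  assumes "v \<in> H1" "inner v (const_L2 1) = 0"
  shows "inner v v \<le> inner (weak_deriv v) (weak_deriv v)"
  using poincare[OF assms(1)] assms(2) by (simp add: norm_le)

lemma mean_zero_primitive:
  assumes V: "subspace V" "V \<subseteq> H1" "const_L2 1 \<in> V" and q: "q \<in> weak_deriv ` V"
  shows "\<exists>r\<in>V. weak_deriv r = q \<and> inner r (const_L2 1) = 0"
proof -
  obtain v where v: "v \<in> V" "weak_deriv v = q" using q by blast
  let ?c = "- inner v (const_L2 1)"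
  have "weak_deriv (v + ?c *\<^sub>R const_L2 1) = weak_deriv v + ?c *\<^sub>R weak_deriv (const_L2 1)"
    using V v subspace_scale[OF V(1,3), of ?c]
    by (subst weak_deriv_add) (auto simp: weak_deriv_scaleR subset_iff simp del: scaleR_minus_left)
  then have "weak_deriv (v + ?c *\<^sub>R const_L2 1) = q"
    using v by (simp add: weak_deriv_const del: scaleR_minus_left)
  moreover have "v + ?c *\<^sub>R const_L2 1 \<in> V"
    by (intro subspace_add subspace_scale V v)
  moreover have "inner (v + ?c *\<^sub>R const_L2 1) (const_L2 1) = 0"
    by (simp add: inner_diff_left inner_const_L2_1)
  ultimately show ?thesis by blast
qed

text \<open>The hypotheses of \<open>lyapunov_step\<close> come from testing the first equation with
  \<open>U\<close> and \<open>R\<close> and the second with \<open>P\<close>. The bound on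
  \<open>(s, U)\<close> needs more: the second equation determines \<open>s\<close> as
  \<open>-\<tau>\<close> times \<open>U\<close> minus its mean.\<close>

lemma theta_step_lyapunov:
  assumes step: "theta_step \<theta> \<tau> a V Q w z n"
    and V: "subspace V" "V \<subseteq> H1" "const_L2 1 \<in> V" and Q: "subspace Q" "Q = weak_deriv ` V"
    and w: "\<And>n. w n \<in> V" and z: "\<And>n. z n \<in> Q"
    and r: "\<And>n. r n \<in> V" "\<And>n. weak_deriv (r n) = z n" "\<And>n. inner (r n) (const_L2 1) = 0"
    and a: "a \<in> borel_measurable M01" "\<forall>x\<in>{0<..<1}. a0 \<le> a x \<and> a x \<le> a1" "0 < a0"
    and eps: "0 < \<epsilon>" "\<epsilon> \<le> 1 / 4" "8 * \<epsilon> \<le> a0" "4 * \<epsilon> * a1 \<le> 1"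
    and \<theta>: "1 / 2 < \<theta>" "\<theta> \<le> 1" and \<tau>: "0 < \<tau>" "\<tau> \<le> (\<theta> - 1 / 2) / 2"
  shows "lyapunov \<epsilon> (w n) (z n) (r n)
    \<le> (1 - 8 / 11 * (\<epsilon> * \<tau>)) * lyapunov \<epsilon> (w (n - 1)) (z (n - 1)) (r (n - 1))"
proof -
  define u d p e where "u = w (n - 1)" and "d = w n - w (n - 1)"
    and "p = z (n - 1)" and "e = z n - z (n - 1)"
  define r0 s where "r0 = r (n - 1)" and "s = r n - r (n - 1)"
  define U P R where "U = u + \<theta> *\<^sub>R d" and "P = p + \<theta> *\<^sub>R e" and "R = r0 + \<theta> *\<^sub>R s"
  have avg: "theta_avg \<theta> w n = U" "theta_avg \<theta> z n = P"
    by (simp_all add: theta_avg_def U_def P_def u_def d_def p_def e_def algebra_simps)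
  have inV: "u \<in> V" "d \<in> V" "r0 \<in> V" "s \<in> V"
    unfolding u_def d_def r0_def s_def by (auto intro: w r subspace_diff[OF V(1)])
  then have UV: "U \<in> V" and RV: "R \<in> V"
    unfolding U_def R_def by (auto intro: subspace_add subspace_scale V(1))
  have inQ: "p \<in> Q" "e \<in> Q"
    unfolding p_def e_def by (auto intro: z subspace_diff[OF Q(1)])
  then have PQ: "P \<in> Q" unfolding P_def by (auto intro: subspace_add subspace_scale Q(1))
  have D_lin: "weak_deriv (x + c *\<^sub>R y) = weak_deriv x + c *\<^sub>R weak_deriv y" if "x \<in> V" "y \<in> V" for x y c
    using that V subspace_scale[OF V(1) that(2), of c]
    by (subst weak_deriv_add) (auto simp: weak_deriv_scaleR subset_iff)
  have "weak_deriv s = e"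
    using D_lin[OF r(1)[of n] r(1)[of "n - 1"], of "-1"] by (simp add: s_def e_def r(2))
  then have DR: "weak_deriv R = P"
    unfolding R_def P_def using D_lin[OF inV(3,4)] by (simp add: r0_def p_def r(2))
  have mean: "inner r0 (const_L2 1) = 0" "inner s (const_L2 1) = 0" "inner R (const_L2 1) = 0"
    by (simp_all add: R_def r0_def s_def r(3) inner_diff_left inner_add_left)
  have eqV: "inner d v = \<tau> * inner P (weak_deriv v) - \<tau> * inner (coeff_mult a U) v" if "v \<in> V" for v
  proof -
    have "1 / \<tau> * inner d v - inner P (weak_deriv v) + inner (coeff_mult a U) v = 0"
      using step that unfolding theta_step_def avg by (simp add: d_def)
    then show ?thesis using \<tau>(1) by (simp add: field_simps)
  qed
  have eqQ: "inner e q = - \<tau> * inner (weak_deriv U) q" if "q \<in> Q" for q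
  proof -
    have "1 / \<tau> * inner e q + inner (weak_deriv U) q = 0"
      using step that unfolding theta_step_def avg by (simp add: e_def)
    then show ?thesis using \<tau>(1) by (simp add: field_simps)
  qed
  let ?k = "s + \<tau> *\<^sub>R U" and ?one = "const_L2 1"
  have "weak_deriv ?k = e + \<tau> *\<^sub>R weak_deriv U"
    using D_lin[OF inV(4) UV] \<open>weak_deriv s = e\<close> by simp
  \<comment> \<open>This element lies in \<open>Q\<close> because \<open>Q\<close> contains the
    derivatives of \<open>V\<close>. Used as its own test function in the second equation, it turns
    out to vanish.\<close>
  moreover have "e + \<tau> *\<^sub>R weak_deriv U \<in> Q"
    using inQ UV Q by (auto intro: subspace_add subspace_scale)
  then have "inner (e + \<tau> *\<^sub>R weak_deriv U) (e + \<tau> *\<^sub>R weak_deriv U) = 0"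
    using eqQ by (subst inner_add_left) simp
  ultimately have "weak_deriv ?k = 0" by simp
  moreover have "?k \<in> H1"
    using V inV UV by (auto intro: subspace_add subspace_scale)
  \<comment> \<open>By the Poincare inequality a zero derivative leaves only the mean, and the mean
    of \<open>?k\<close> is \<open>\<tau>\<close> times that of \<open>U\<close> since
    \<open>s\<close> has mean zero.\<close>
  ultimately have "?k = inner ?k ?one *\<^sub>R ?one"
    using poincare[of ?k] by simp
  then have "s = (\<tau> * inner U ?one) *\<^sub>R ?one - \<tau> *\<^sub>R U"
    using mean(2) by (simp add: inner_add_left algebra_simps)
  then have "inner s U = \<tau> * (inner U ?one)\<^sup>2 - \<tau> * inner U U"
    by (simp add: inner_diff_left inner_commute[of ?one U] power2_eq_square)
  then have eq4: "- \<tau> * inner U U \<le> inner s U"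
    using \<tau>(1) by simp
  have "lyapunov \<epsilon> (u + d) (p + e) (r0 + s) \<le> (1 - 8 / 11 * (\<epsilon> * \<tau>)) * lyapunov \<epsilon> u p r0"
  proof (rule lyapunov_step[where A = "coeff_mult a U" and D = "weak_deriv U"
        and \<theta> = \<theta> and ?a0.0 = a0 and ?a1.0 = a1],
      unfold U_def[symmetric] P_def[symmetric] R_def[symmetric])
    show "inner d R = \<tau> * inner P P - \<tau> * inner (coeff_mult a U) R"
      using eqV[OF RV] DR by simp
    show "inner r0 r0 \<le> inner p p" "inner R R \<le> inner P P" "inner s s \<le> inner e e"
      using inner_weak_deriv_ge[of r0] inner_weak_deriv_ge[of R] inner_weak_deriv_ge[of s]
        inV RV V mean DR \<open>weak_deriv s = e\<close> r(2)[of "n - 1"] by (auto simp: r0_def p_def subset_iff)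
  qed (use eqV[OF UV] eqQ[OF PQ] eq4 coeff_mult_ge[OF a] coeff_mult_le[OF a] eps \<theta> \<tau> in simp_all)
  then show ?thesis by (simp add: u_def d_def p_def e_def r0_def s_def)
qed

section \<open>Admissible constants and iteration in time\<close>

lemma decay_rate_bounds:
  assumes "0 < a0" "a0 \<le> a1"
  defines "\<epsilon> \<equiv> 3 / 2 * decay_rate a0 a1"
  shows "0 < \<epsilon>" "\<epsilon> \<le> 1 / 4" "8 * \<epsilon> \<le> a0" "4 * \<epsilon> * a1 \<le> 1"
proof -
  define den where "den = 8 * a0\<^sup>2 + 4 * a0\<^sup>2 * a1 + 3 * a0 * a1 + 4 * a1 ^ 4"
  have "decay_rate a0 a1 = 2 / 3 * (a0 ^ 3 / den)"
    by (simp only: decay_rate_def den_def)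
  then have eps: "\<epsilon> = a0 ^ 3 / den" by (simp add: \<epsilon>_def)
  have pos: "0 < a0\<^sup>2" "0 < a0\<^sup>2 * a1" "0 < a0 * a1" "0 < a1 ^ 4" using assms(1,2) by auto
  \<comment> \<open>Each lower bound on the denominator serves one estimate: \<open>8 a0^2\<close>
    gives \<open>8 \<epsilon> \<le> a0\<close>, \<open>4 a0^2 a1\<close> gives
    \<open>\<epsilon> \<le> 1/4\<close>, and \<open>4 a1^4\<close> gives
    \<open>4 \<epsilon> a1 \<le> 1\<close>.\<close>
  then have den: "0 < den" "8 * a0\<^sup>2 \<le> den" "4 * a0\<^sup>2 * a1 \<le> den" "4 * a1 ^ 4 \<le> den"
    unfolding den_def by linarith+
  show "0 < \<epsilon>" using den assms(1,2) by (simp add: eps)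
  have "4 * a0 ^ 3 \<le> 4 * a0\<^sup>2 * a1" using assms(1,2) by (simp add: power3_eq_cube power2_eq_square)
  then show "\<epsilon> \<le> 1 / 4" using den by (simp add: eps field_simps)
  have "a0 * (8 * a0\<^sup>2) \<le> a0 * den" using den assms(1,2) by (intro mult_left_mono) auto
  then show "8 * \<epsilon> \<le> a0" using den by (simp add: eps field_simps power3_eq_cube power2_eq_square)
  have "a0 ^ 3 * a1 \<le> a1 ^ 3 * a1" using assms(1,2) by (intro mult_right_mono power_mono) auto
  also have "\<dots> = a1 ^ 4" by (simp add: eval_nat_numeral)
  finally show "4 * \<epsilon> * a1 \<le> 1" using den by (simp add: eps field_simps)
qed

text \<open>The one-step contraction of the Lyapunov functional is iterated from \<open>m\<close> to
  \<open>n\<close>. Passing from energy to functional and back costs the factor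
  \<open>(5/4) / (3/4) = 5/3\<close>, which is below 3.\<close>

lemma energy_decay:
  assumes scheme: "theta_scheme \<theta> \<tau> a V Q u0 p0 u p"
    and V: "subspace V" "V \<subseteq> H1" "const_L2 1 \<in> V" and Q: "subspace Q" "Q = weak_deriv ` V"
    and a: "a \<in> borel_measurable M01" "\<forall>x\<in>{0<..<1}. a0 \<le> a x \<and> a x \<le> a1" "0 < a0"
    and \<theta>: "1 / 2 < \<theta>" "\<theta> \<le> 1" and \<tau>: "0 < \<tau>" "\<tau> \<le> (\<theta> - 1 / 2) / 2"
    and "k \<le> m" "m \<le> n"
  shows "energy \<tau> u p k n \<le> 3 * exp (- decay_rate a0 a1 * real (n - m) * \<tau>) * energy \<tau> u p k m"
proof -
  define \<epsilon> where "\<epsilon> = 3 / 2 * decay_rate a0 a1"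
  have "a0 \<le> a1" using a(2) by (auto dest: bspec[of _ _ "1/2"])
  note eps = decay_rate_bounds[OF a(3) this, folded \<epsilon>_def]
  let ?w = "bdq \<tau> k u" and ?z = "bdq \<tau> k p"
  have w: "?w j \<in> V" and z: "?z j \<in> Q" for j
    using scheme bdq_in_subspace V(1) Q(1) unfolding theta_scheme_def by blast+
  then have "\<forall>j. \<exists>r\<in>V. weak_deriv r = ?z j \<and> inner r (const_L2 1) = 0"
    using mean_zero_primitive[OF V] Q(2) by blast
  then obtain r where r: "r j \<in> V" "weak_deriv (r j) = ?z j" "inner (r j) (const_L2 1) = 0" for j
    by metis
  define L where "L j = lyapunov \<epsilon> (?w j) (?z j) (r j)" for j
  have "inner (r j) (r j) \<le> inner (?z j) (?z j)" for j
    using inner_weak_deriv_ge[of "r j"] r[of j] V(2) by auto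
  from lyapunov_bounds[OF this, of \<epsilon> "?w _"]
  have L: "3 / 4 * energy \<tau> u p k j \<le> L j" "L j \<le> 5 / 4 * energy \<tau> u p k j" for j
    using eps by (simp_all add: L_def energy_def power2_norm_eq_inner)
  have L_nonneg: "0 \<le> L j" for j
    using L(1)[of j] by (simp add: energy_def) (smt (verit) zero_le_power2)
  let ?\<alpha> = "decay_rate a0 a1"
  \<comment> \<open>Order-\<open>k\<close> quotients obey the scheme only above level
    \<open>k\<close>; this suffices, as the first step taken leads from \<open>m\<close> to
    \<open>m + 1\<close>.\<close>
  have L_step: "L j \<le> exp (- ?\<alpha> * \<tau>) * L (j - 1)" if "k < j" for j
  proof -
    have "theta_step \<theta> \<tau> a V Q ?w ?z j"
      using scheme that V a by (intro theta_step_bdq[of \<theta> \<tau> a V Q u p])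
        (auto simp: theta_step_def theta_scheme_def
          simp del: bdq.simps)
    then have "L j \<le> (1 - 8 / 11 * (\<epsilon> * \<tau>)) * L (j - 1)"
      unfolding L_def using V Q w z r a eps \<theta> \<tau> by (rule theta_step_lyapunov)
    \<comment> \<open>Since the rate is \<open>2/3 \<epsilon>\<close> and \<open>2/3 < 8/11\<close>,
      the left side is at most \<open>1 - \<alpha> \<tau>\<close>, which lies below the
      exponential.\<close>
    also have "1 - 8 / 11 * (\<epsilon> * \<tau>) \<le> exp (- ?\<alpha> * \<tau>)"
    proof -
      have "?\<alpha> * \<tau> = 2 / 3 * (\<epsilon> * \<tau>)" by (simp add: \<epsilon>_def)
      moreover have "0 < \<epsilon> * \<tau>" using eps \<tau> by simp
      ultimately have "1 - 8 / 11 * (\<epsilon> * \<tau>) \<le> 1 + (- ?\<alpha> * \<tau>)" by linarith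
      also have "\<dots> \<le> exp (- ?\<alpha> * \<tau>)" by (rule exp_ge_add_one_self)
      finally show ?thesis .
    qed
    finally show ?thesis using L_nonneg by (simp add: mult_right_mono)
  qed
  have "L n \<le> exp (- ?\<alpha> * real (n - m) * \<tau>) * L m"
    using \<open>m \<le> n\<close>
  proof (induction n rule: dec_induct)
    case (step n)
    have "L (Suc n) \<le> exp (- ?\<alpha> * \<tau>) * L n"
      using step.hyps \<open>k \<le> m\<close> L_step[of "Suc n"] by simp
    also have "\<dots> \<le> exp (- ?\<alpha> * \<tau>) * (exp (- ?\<alpha> * real (n - m) * \<tau>) * L m)"
      using step.IH by (intro mult_left_mono) auto
    also have "\<dots> = exp (- ?\<alpha> * real (Suc n - m) * \<tau>) * L m"
      using \<open>m \<le> n\<close> by (simp add: Suc_diff_le mult_exp_exp algebra_simps)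
    finally show ?case .
  qed simp
  also have "\<dots> \<le> exp (- ?\<alpha> * real (n - m) * \<tau>) * (5 / 4 * energy \<tau> u p k m)"
    using L(2) by (intro mult_left_mono) auto
  finally have "energy \<tau> u p k n \<le> 5 / 3 * (exp (- ?\<alpha> * real (n - m) * \<tau>) * energy \<tau> u p k m)"
    using L(1)[of n] by simp
  moreover have "0 \<le> exp (- ?\<alpha> * real (n - m) * \<tau>) * energy \<tau> u p k m"
    by (simp add: energy_def)
  ultimately show ?thesis by linarith
qed

theorem theorem7p4:
  fixes a0 a1 \<theta> :: real
  assumes "0 < a0" and "1 / 2 < \<theta>" and "\<theta> \<le> 1"
  shows "\<exists>\<tau>0>0. \<forall>(a :: real \<Rightarrow> real) (\<tau> :: real) (V :: L2 set) (Q :: L2 set)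
           (u0 :: L2) (p0 :: L2) (u :: nat \<Rightarrow> L2) (p :: nat \<Rightarrow> L2).
           a \<in> borel_measurable (lebesgue_on {0<..<1}) \<and>
           (\<forall>x\<in>{0<..<1}. a0 \<le> a x \<and> a x \<le> a1) \<and>
           0 < \<tau> \<and> \<tau> \<le> \<tau>0 \<and>
           fin_dim_subspace V \<and> V \<subseteq> H1 \<and> fin_dim_subspace Q \<and>
           Q = weak_deriv ` V \<and> const_L2 1 \<in> V \<and>
           theta_scheme \<theta> \<tau> a V Q u0 p0 u p \<longrightarrow>
           (\<forall>k m n. k \<le> m \<and> m \<le> n \<longrightarrow>
              energy \<tau> u p k n
                \<le> 3 * exp (- decay_rate a0 a1 * real (n - m) * \<tau>) * energy \<tau> u p k m)"
proof (intro exI[of _ "(\<theta> - 1 / 2) / 2"] conjI allI impI)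
  \<comment> \<open>The witness for \<open>\<tau>0\<close> is the step bound of
    \<open>lyapunov_step\<close>; it depends on \<open>\<theta>\<close> alone.\<close>
  show "0 < (\<theta> - 1 / 2) / 2" using assms by simp
qed (use assms in \<open>auto simp only: fin_dim_subspace_def intro!: energy_decay\<close>)

end
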